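(* Let $0<a<1$ with $a\neq 1/2$. Then the periodic zeta function $\mathrm{Li}_s(e^{2\pi i a})$ has no zeros on the real line, i.e. $\mathrm{Li}_\sigma(e^{2\pi i a})\neq 0$ for every $\sigma\in\mathbb{R}$.
   Context: For $0<a<1$ the periodic zeta function is defined for $\Re(s)>1$ by $\mathrm{Li}_s(e^{2\pi i a})=\sum_{n=1}^\infty e^{2\pi i n a}n^{-s}$; it extends by analytic continuation to an entire function of $s\in\mathbb{C}$. Write $s=\sigma+it$ with $\sigma,t\in\mathbb{R}$. *)

theory Defs
  imports "HOL-Complex_Analysis.Complex_Analysis"
begin

text \<open>
  The Dirichlet series of the periodic zeta function, the sum over $n \geq 1$ of
  $e^{2\pi i n a} n^{-s}$. The index is shifted by one.
\<close>

definition periodic_zeta_term :: "real \<Rightarrow> complex \<Rightarrow> nat \<Rightarrow> complex" where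
  "periodic_zeta_term a s n =
     exp (2 * of_real pi * \<i> * of_nat (Suc n) * of_real a) * of_nat (Suc n) powr (- s)"

definition is_periodic_zeta :: "real \<Rightarrow> (complex \<Rightarrow> complex) \<Rightarrow> bool" where
  "is_periodic_zeta a f \<longleftrightarrow>
     f holomorphic_on UNIV \<and> (\<forall>s. Re s > 1 \<longrightarrow> periodic_zeta_term a s sums f s)"

text \<open>
  The function $s \mapsto \mathrm{Li}_s(e^{2\pi i a})$: the entire continuation of the series. It
  exists for $0 < a < 1$, and there is at most one for any $a$ by the lemma
  \<open>is_periodic_zeta_unique\<close>. For integer $a$ the series is that of the Riemann zeta function,
  which has a pole at $1$, and the description denotes no particular function.
\<close>

definition periodic_zeta :: "real \<Rightarrow> complex \<Rightarrow> complex" where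
  "periodic_zeta a = (THE f. is_periodic_zeta a f)"

lemma is_periodic_zeta_unique:
  assumes "is_periodic_zeta a f" "is_periodic_zeta a g"
  shows "f = g"
proof
  fix w
  have eq: "f z = g z" if "z \<in> {s. Re s > 1}" for z
    using assms that unfolding is_periodic_zeta_def by (blast intro: sums_unique2)
  show "f w = g w"
  proof (rule analytic_continuation_open[where s = "{s. Re s > 1}" and s' = UNIV and f = f and g = g])
    show "open {s. Re s > 1}" by (rule open_halfspace_Re_gt)
    show "{s. Re s > 1} \<noteq> {}" by (auto intro!: exI[of _ 2])
  qed (use assms in \<open>auto simp: is_periodic_zeta_def intro!: eq\<close>)
qed

lemma periodic_zeta_eqI: "is_periodic_zeta a f \<Longrightarrow> periodic_zeta a = f"
  unfolding periodic_zeta_def by (blast intro: is_periodic_zeta_unique)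

end

theory Submission
  imports Defs "HOL-Real_Asymp.Real_Asymp"
begin

text \<open>
  Let $z = e^{2\pi i a}$ and $\varphi_n(x) = \sum_{k \geq 1} k^n z^k e^{-kx}$ for $n \geq 1$. By the
  Lipschitz formula, $\varphi_n(x)$ is $n!$ times the sum of $(x - 2\pi i (a + k))^{-n-1}$ over all
  integers $k$; hence it is bounded near $0$, and the Mellin transform
  $\Gamma(s+n)^{-1} \int_0^\infty x^{s+n-1} \varphi_n(x)\,dx$ continues the Dirichlet series to
  $\mathrm{Re}\, s > -n$.

  For $\sigma > -1$ take $n = 1$: with $q = z e^{-x}$, the imaginary part of
  $\varphi_1(x) = q/(1-q)^2$ is a positive multiple of $\sin(2\pi a) \neq 0$, so the integral does not
  vanish. For $\sigma < 0$ take $n$ with $0 < p = \sigma + n \leq 1$ and integrate the poles term by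
  term: up to the factor $n!$ the integral is $A(a) J + A(1-a) \overline{J}$, where
  $A(b) = \sum_{k \geq 0} (2\pi(b+k))^{\sigma-1}$ is strictly decreasing in $b$ and
  $J = \int_0^\infty u^{p-1} (u-i)^{-n-1}\,du \neq 0$. So the two summands have different absolute
  values if $a \neq 1/2$.
\<close>

section \<open>Mellin transforms\<close>

text \<open>Restricting the measure, rather than using set integrals, lets dominated convergence and
  termwise integration apply directly; \<open>x > 0\<close> comes from the space.\<close>

abbreviation halfline :: "real measure" where
  "halfline \<equiv> restrict_space lborel {0<..}"

lemma borel_measurable_halfline:
  fixes f :: "real \<Rightarrow> 'a::topological_space"
  assumes "continuous_on {0<..} f"
  shows "f \<in> borel_measurable halfline"
  using borel_measurable_continuous_on_restrict[OF assms]
  by (simp add: measurable_cong_sets sets_restrict_space)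

lemma has_bochner_integral_halfline_iff:
  fixes f :: "real \<Rightarrow> 'a::{banach, second_countable_topology}"
  shows "has_bochner_integral halfline f v \<longleftrightarrow>
         has_bochner_integral lborel (\<lambda>x. indicator {0<..} x *\<^sub>R f x) v"
  by (simp add: has_bochner_integral_restrict_space)

lemma has_bochner_integral_halfline_scale:
  fixes f :: "real \<Rightarrow> 'a::{banach, second_countable_topology}"
  assumes "has_bochner_integral halfline f v" "c > 0"
  shows "has_bochner_integral halfline (\<lambda>x. f (c * x)) (v /\<^sub>R c)"
proof -
  have "has_bochner_integral lborel (\<lambda>x. indicator {0<..} (0 + c * x) *\<^sub>R f (0 + c * x)) (v /\<^sub>R \<bar>c\<bar>)"
    using assms unfolding has_bochner_integral_halfline_iff
    by (subst lborel_has_bochner_integral_real_affine_iff[where c = c and t = 0, symmetric]) auto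
  also have "(\<lambda>x. indicator {0<..} (0 + c * x) *\<^sub>R f (0 + c * x)) = (\<lambda>x. indicator {0<..} x *\<^sub>R f (c * x))"
    using assms(2) by (auto simp: fun_eq_iff indicator_def zero_less_mult_iff)
  finally show ?thesis using assms(2) by (simp add: has_bochner_integral_halfline_iff)
qed

text \<open>Euler's integral is the case \<open>c = 1\<close>; the general case follows by the
  dilation x -> c x.\<close>

lemma has_bochner_integral_Gamma:
  assumes "Re s > 0" "c > 0"
  shows "has_bochner_integral halfline (\<lambda>x. of_real x powr (s - 1) * exp (- of_real (c * x)))
           (Gamma s * of_real c powr (- s))"
proof -
  let ?f = "\<lambda>t. of_real t powr (s - 1) / of_real (exp t) :: complex"
  have m: "?f \<in> borel_measurable halfline"
    by (intro borel_measurable_halfline continuous_intros) (auto simp: complex_nonpos_Reals_iff)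
  \<comment> \<open>Absolute integrability refers to the completed measure; Borel measurability
    carries the integral over to \<open>lborel\<close>.\<close>
  have mI: "(\<lambda>x. indicator {0<..} x *\<^sub>R ?f x) \<in> borel_measurable lborel"
    using m by (simp add: borel_measurable_restrict_space_iff)
  have ai: "?f absolutely_integrable_on {0<..}"
    by (rule absolutely_integrable_Gamma_integral'[OF assms(1)])
  then have i: "integrable lborel (\<lambda>x. indicator {0<..} x *\<^sub>R ?f x)"
    using mI unfolding set_integrable_def by (simp add: integrable_completion)
  have "integral\<^sup>L lborel (\<lambda>x. indicator {0<..} x *\<^sub>R ?f x) = integral {0<..} ?f"
    using set_lebesgue_integral_eq_integral(2)[OF ai] mI
    by (simp add: set_lebesgue_integral_def integral_completion)
  also have "\<dots> = Gamma s"
    using Gamma_integral_complex'[OF assms(1)] by (rule integral_unique)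
  finally have "has_bochner_integral halfline ?f (Gamma s)"
    using i unfolding has_bochner_integral_halfline_iff by (simp only: has_bochner_integral_iff)
  from has_bochner_integral_halfline_scale[OF this assms(2)]
  have "has_bochner_integral halfline (\<lambda>x. ?f (c * x)) (Gamma s /\<^sub>R c)" .
  \<comment> \<open>The factor c^(1-s) cancels the c^(s-1) produced by dilating the power; with the
    Jacobian 1/c the value becomes Gamma(s) c^(-s).\<close>
  from has_bochner_integral_mult_left[OF this, of "of_real c powr (1 - s)"]
  have "has_bochner_integral halfline (\<lambda>x. ?f (c * x) * of_real c powr (1 - s))
          (Gamma s /\<^sub>R c * of_real c powr (1 - s))" by simp
  also have "Gamma s /\<^sub>R c * of_real c powr (1 - s) = Gamma s * of_real c powr (- s)"
    using assms(2) by (simp add: powr_diff powr_minus scaleR_conv_of_real field_simps)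
  finally show ?thesis
  proof (rule has_bochner_integral_cong[THEN iffD1, rotated -1])
    fix x assume "x \<in> space halfline"
    then have x: "x > 0" by (simp add: space_restrict_space)
    have "of_real (c * x) powr (s - 1) = of_real c powr (s - 1) * (of_real x powr (s - 1) :: complex)"
      using x assms(2) by (simp add: powr_times_real)
    moreover have "of_real c powr (s - 1) * of_real c powr (1 - s) = (1::complex)"
      using assms(2) by (simp flip: powr_add)
    moreover have "exp (of_real c * of_real x) = complex_of_real (exp (c * x))"
      by (simp flip: exp_of_real)
    ultimately show "?f (c * x) * of_real c powr (1 - s) = of_real x powr (s - 1) * exp (- of_real (c * x))"
      by (simp add: exp_minus field_simps)
  qed auto
qed

lemma has_bochner_integral_Gamma_real:
  assumes "s > 0" "c > 0"
  shows "has_bochner_integral halfline (\<lambda>x. x powr (s - 1) * exp (- (c * x)))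
           (Gamma s * c powr (- s))"
proof -
  have "has_bochner_integral halfline (\<lambda>x. of_real x powr (of_real s - 1) * exp (- of_real (c * x)))
           (Gamma (of_real s) * of_real c powr (- of_real s) :: complex)"
    using assms by (intro has_bochner_integral_Gamma) auto
  also have "Gamma (of_real s) * of_real c powr (- of_real s) = complex_of_real (Gamma s * c powr (-s))"
    using assms by (simp add: Gamma_complex_of_real powr_of_real flip: of_real_minus)
  finally have "has_bochner_integral halfline (\<lambda>x. complex_of_real (x powr (s - 1) * exp (- (c * x))))
     (complex_of_real (Gamma s * c powr (-s)))"
  proof (rule has_bochner_integral_cong[THEN iffD1, rotated -1])
    fix x assume "x \<in> space halfline"
    then show "complex_of_real x powr (of_real s - 1) * exp (- of_real (c * x)) =
       complex_of_real (x powr (s - 1) * exp (- (c * x)))"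
      by (simp add: space_restrict_space powr_of_real exp_of_real flip: of_real_diff of_real_minus of_real_mult)
         (simp flip: powr_of_real)
  qed auto
  from has_bochner_integral_Re[OF this] show ?thesis by simp
qed

text \<open>By the mean value inequality the quotient is at most |L| e^(d|L|), and |L| \<le>
  e^(d|L|)/d. The bound is uniform in \<open>h\<close>; for L = ln x it turns into a sum of powers
  of x.\<close>

lemma norm_exp_quotient_le:
  fixes h :: complex and L d :: real
  assumes "h \<noteq> 0" "norm h \<le> d" "d > 0"
  shows "norm ((exp (h * of_real L) - 1) / h) \<le> (exp (2 * d * L) + exp (- (2 * d * L))) / d"
proof -
  have "norm (exp (h * of_real L) - 1) \<le> exp (norm (h * of_real L)) * norm (h * of_real L)"
  proof -
    have "norm (exp (h * of_real L) - exp 0) \<le> exp (norm (h * of_real L)) * norm (h * of_real L - 0)"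
    proof (rule field_differentiable_bound[where S = "cball 0 (norm (h * of_real L))" and f' = exp])
      fix z :: complex assume "z \<in> cball 0 (norm (h * of_real L))"
      then show "norm (exp z) \<le> exp (norm (h * of_real L))"
        by (metis dist_0_norm exp_le_cancel_iff mem_cball norm_exp order_trans)
    qed (auto intro!: derivative_eq_intros)
    then show ?thesis by simp
  qed
  then have "norm ((exp (h * of_real L) - 1) / h) \<le> exp (norm h * \<bar>L\<bar>) * \<bar>L\<bar>"
    using assms(1) by (simp add: norm_divide norm_mult field_simps)
  also have "\<dots> \<le> exp (d * \<bar>L\<bar>) * (exp (d * \<bar>L\<bar>) / d)"
  proof (intro mult_mono)
    have "d * \<bar>L\<bar> \<le> exp (d * \<bar>L\<bar>)" using exp_ge_add_one_self[of "d * \<bar>L\<bar>"] by linarith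
    then show "\<bar>L\<bar> \<le> exp (d * \<bar>L\<bar>) / d" using assms(3) by (simp add: field_simps)
  qed (use assms in \<open>auto intro!: mult_right_mono\<close>)
  also have "\<dots> = exp (2 * d * \<bar>L\<bar>) / d" by (simp flip: exp_add)
  also have "\<dots> \<le> (exp (2 * d * L) + exp (- (2 * d * L))) / d"
    using assms(3) by (intro divide_right_mono) (auto simp: abs_if)
  finally show ?thesis .
qed

section \<open>Convergence and holomorphy of Mellin integrals\<close>

lemma integrable_Mellin:
  fixes \<phi> :: "real \<Rightarrow> complex"
  assumes "\<phi> \<in> borel_measurable halfline"
    and bound: "\<And>x. x > 0 \<Longrightarrow> norm (\<phi> x) \<le> C * exp (- x)" and "Re s > 0"
  shows "integrable halfline (\<lambda>x. of_real x powr (s - 1) * \<phi> x)"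
proof (rule Bochner_Integration.integrable_bound)
  show "integrable halfline (\<lambda>x. C * (x powr (Re s - 1) * exp (- (1 * x))))"
    using has_bochner_integral_Gamma_real[OF assms(3) zero_less_one]
    by (intro integrable_mult_right) (auto simp: has_bochner_integral_iff)
  have "(\<lambda>x. complex_of_real x powr (s - 1)) \<in> borel_measurable halfline"
    by (intro borel_measurable_halfline continuous_intros) (auto simp: complex_nonpos_Reals_iff)
  then show "(\<lambda>x. of_real x powr (s - 1) * \<phi> x) \<in> borel_measurable halfline"
    using assms(1) by measurable
  have "norm (of_real x powr (s - 1) * \<phi> x) \<le> norm (C * (x powr (Re s - 1) * exp (- (1 * x))))" if x: "x > 0" for x
  proof -
    have "norm (of_real x powr (s - 1) * \<phi> x) = x powr (Re s - 1) * norm (\<phi> x)"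
      using x by (simp add: norm_mult norm_powr_real_powr)
    also have "\<dots> \<le> x powr (Re s - 1) * (C * exp (- x))"
      using bound[OF x] by (intro mult_left_mono) auto
    also have "\<dots> \<le> \<bar>x powr (Re s - 1) * (C * exp (- x))\<bar>" by simp
    finally show ?thesis by (simp add: mult_ac)
  qed
  then show "AE x in halfline. norm (of_real x powr (s - 1) * \<phi> x) \<le>
      norm (C * (x powr (Re s - 1) * exp (- (1 * x))))"
    by (intro AE_I2) (simp add: space_restrict_space)
qed

text \<open>Differentiation under the integral sign: with $3\delta = \mathrm{Re}\, s$ the difference
  quotients of $x^{s-1}$ are dominated by $(x^{\sigma-1-2\delta} + x^{\sigma-1+2\delta})/\delta$.\<close>

lemma holomorphic_Mellin:
  fixes \<phi> :: "real \<Rightarrow> complex"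
  assumes meas: "\<phi> \<in> borel_measurable halfline"
    and bound: "\<And>x. x > 0 \<Longrightarrow> norm (\<phi> x) \<le> C * exp (- x)"
  shows "(\<lambda>s. \<integral>x. of_real x powr (s - 1) * \<phi> x \<partial>halfline) holomorphic_on {s. Re s > 0}"
proof -
  let ?M = "\<lambda>s. \<integral>x. of_real x powr (s - 1) * \<phi> x \<partial>halfline"
  have C: "C \<ge> 0"
    using order_trans[OF norm_ge_zero bound[of 1]] by (simp add: zero_le_mult_iff)
  have powm: "(\<lambda>x. complex_of_real x powr w) \<in> borel_measurable halfline" for w
    by (intro borel_measurable_halfline continuous_intros) (auto simp: complex_nonpos_Reals_iff)
  have lnm: "(\<lambda>x. complex_of_real (ln x)) \<in> borel_measurable halfline"
    by (intro borel_measurable_halfline continuous_intros) auto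
  have "(?M has_field_derivative (\<integral>x. of_real (ln x) * of_real x powr (s - 1) * \<phi> x \<partial>halfline)) (at s)"
    if s: "Re s > 0" for s
    unfolding has_field_derivative_def[symmetric] DERIV_def tendsto_at_iff_sequentially comp_def
  proof (intro allI impI)
    fix h :: "nat \<Rightarrow> complex"
    assume h0: "\<forall>i. h i \<in> UNIV - {0}" and h: "h \<longlonglongrightarrow> 0"
    define d where "d = Re s / 3"
    have d: "d > 0" using s by (simp add: d_def)
    from h have "\<forall>\<^sub>F i in sequentially. norm (h i) < d"
      using d by (metis order_tendstoD(2) norm_zero tendsto_norm)
    then obtain N where N: "\<And>i. i \<ge> N \<Longrightarrow> norm (h i) < d" by (auto simp: eventually_sequentially)
    \<comment> \<open>Dropping finitely many terms makes every increment smaller than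
      \<open>d\<close>, so one majorant serves for all indices.\<close>
    define g where "g = (\<lambda>i. h (i + N))"
    have g: "g i \<noteq> 0" "norm (g i) < d" for i using h0 N by (auto simp: g_def)
    have g_lim: "g \<longlonglongrightarrow> 0" unfolding g_def by (rule LIMSEQ_ignore_initial_segment[OF h])
    let ?q = "\<lambda>i x. of_real x powr (s - 1) * ((exp (g i * of_real (ln x)) - 1) / g i) * \<phi> x"
    \<comment> \<open>Since \<open>Re s = 3 * d\<close>, the smaller parameter
      \<open>Re s - 2 * d\<close> is \<open>d > 0\<close>, and both Gamma integrals
      converge.\<close>
    let ?w = "\<lambda>x. C / d * (x powr ((Re s + 2 * d) - 1) * exp (- (1 * x))) +
                  C / d * (x powr ((Re s - 2 * d) - 1) * exp (- (1 * x)))"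
    have quot: "(?M (s + g i) - ?M s) / g i = (\<integral>x. ?q i x \<partial>halfline)" for i
    proof -
      have "Re (s + g i) > 0"
        using abs_Re_le_cmod[of "g i"] g(2)[of i] s unfolding d_def by (auto simp: abs_le_iff)
      then have "?M (s + g i) - ?M s = (\<integral>x. of_real x powr (s + g i - 1) * \<phi> x - of_real x powr (s - 1) * \<phi> x \<partial>halfline)"
        using s by (intro Bochner_Integration.integral_diff[symmetric] integrable_Mellin[OF meas bound]) auto
      then have "(?M (s + g i) - ?M s) / g i =
         (\<integral>x. (of_real x powr (s + g i - 1) * \<phi> x - of_real x powr (s - 1) * \<phi> x) / g i \<partial>halfline)"
        by simp
      also have "\<dots> = (\<integral>x. ?q i x \<partial>halfline)"
      proof (rule Bochner_Integration.integral_cong[OF refl])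
        fix x assume "x \<in> space halfline"
        then have x: "x > 0" by (simp add: space_restrict_space)
        have "of_real x powr (s + g i - 1) = of_real x powr (s - 1) * exp (g i * of_real (ln x))"
          using x by (simp add: powr_def Ln_of_real flip: exp_add) (simp add: algebra_simps)
        then show "(of_real x powr (s + g i - 1) * \<phi> x - of_real x powr (s - 1) * \<phi> x) / g i = ?q i x"
          using g(1)[of i] by (simp add: field_simps)
      qed
      finally show ?thesis .
    qed
    have "(\<lambda>i. \<integral>x. ?q i x \<partial>halfline) \<longlonglongrightarrow> (\<integral>x. of_real x powr (s - 1) * of_real (ln x) * \<phi> x \<partial>halfline)"
    proof (rule integral_dominated_convergence[where w = ?w])
      show "integrable halfline ?w"
        using has_bochner_integral_Gamma_real[of "Re s + 2 * d" 1]
              has_bochner_integral_Gamma_real[of "Re s - 2 * d" 1] s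
        unfolding has_bochner_integral_iff
        by (intro Bochner_Integration.integrable_add integrable_mult_right) (auto simp: d_def)
      show "(\<lambda>x. of_real x powr (s - 1) * of_real (ln x) * \<phi> x) \<in> borel_measurable halfline"
        using meas powm lnm by measurable
      show "?q i \<in> borel_measurable halfline" for i
        using meas powm[of "s - 1"] lnm by measurable
      have "(\<lambda>i. ?q i x) \<longlonglongrightarrow> of_real x powr (s - 1) * of_real (ln x) * \<phi> x" for x
      proof -
        have "((\<lambda>h. exp (h * of_real (ln x))) has_field_derivative of_real (ln x)) (at (0::complex))"
          by (auto intro!: derivative_eq_intros)
        then have "(\<lambda>h. (exp (h * of_real (ln x)) - 1) / h) \<midarrow>(0::complex)\<rightarrow> of_real (ln x)"
          by (simp add: DERIV_def)
        moreover have "filterlim g (at 0) sequentially"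
          using g_lim g(1) by (auto simp: filterlim_at)
        ultimately have "(\<lambda>i. (exp (g i * of_real (ln x)) - 1) / g i) \<longlonglongrightarrow> of_real (ln x)"
          by (rule filterlim_compose)
        then show ?thesis by (intro tendsto_intros)
      qed
      then show "AE x in halfline. (\<lambda>i. ?q i x) \<longlonglongrightarrow> of_real x powr (s - 1) * of_real (ln x) * \<phi> x"
        by simp
      have "norm (?q i x) \<le> ?w x" if x: "x > 0" for x i
      proof -
        have "norm (?q i x) = x powr (Re s - 1) * norm ((exp (g i * of_real (ln x)) - 1) / g i) * norm (\<phi> x)"
          using x by (simp add: norm_mult norm_divide norm_powr_real_powr)
        also have "\<dots> \<le> x powr (Re s - 1) * ((exp (2 * d * ln x) + exp (- (2 * d * ln x))) / d) * (C * exp (-x))"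
          using d g[of i] bound[OF x]
          by (intro mult_mono norm_exp_quotient_le mult_nonneg_nonneg divide_nonneg_nonneg add_nonneg_nonneg) auto
        also have "exp (2 * d * ln x) = x powr (2 * d)" using x by (simp add: powr_def)
        also have "exp (- (2 * d * ln x)) = x powr (- 2 * d)" using x by (simp add: powr_def)
        also have "x powr (Re s - 1) * ((x powr (2 * d) + x powr (- 2 * d)) / d) * (C * exp (-x)) =
            C / d * (x powr (Re s - 1) * x powr (2 * d) * exp (- x)) + C / d * (x powr (Re s - 1) * x powr (- 2 * d) * exp (-x))"
          by (simp add: algebra_simps add_divide_distrib)
        also have "\<dots> = ?w x"
          using x by (simp flip: powr_add add: algebra_simps)
        finally show ?thesis .
      qed
      then show "AE x in halfline. norm (?q i x) \<le> ?w x" for i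
        by (intro AE_I2) (simp add: space_restrict_space)
    qed
    then have "(\<lambda>i. (?M (s + g i) - ?M s) / g i) \<longlonglongrightarrow> (\<integral>x. of_real (ln x) * of_real x powr (s - 1) * \<phi> x \<partial>halfline)"
      unfolding quot by (simp add: mult_ac)
    then show "(\<lambda>i. (?M (s + h i) - ?M s) / h i) \<longlonglongrightarrow> (\<integral>x. of_real (ln x) * of_real x powr (s - 1) * \<phi> x \<partial>halfline)"
      unfolding g_def by (rule LIMSEQ_offset)
  qed
  then show ?thesis
    by (intro holomorphic_onI) (auto simp: field_differentiable_def intro: has_field_derivative_at_within)
qed

section \<open>The Lipschitz formula\<close>

text \<open>On the unit disc this is the polylogarithm of order -n for \<open>n > 0\<close>, where
  the term \<open>k = 0\<close> vanishes. For \<open>n = 0\<close> that term is 1 and the sum is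
  1/(1-q).\<close>

definition neg_polylog :: "nat \<Rightarrow> complex \<Rightarrow> complex" where
  "neg_polylog n q = (\<Sum>k. of_nat k ^ n * q ^ k)"

text \<open>Termwise differentiation preserves convergence inside the unit disc, and multiplying the
  derived series by \<open>q\<close> raises the power of \<open>k\<close> by one.\<close>

lemma summable_neg_polylog:
  fixes q :: "'a :: {real_normed_field, banach}"
  assumes "norm q < 1"
  shows "summable (\<lambda>k. of_nat k ^ n * q ^ k)"
  using assms
proof (induction n arbitrary: q)
  case 0
  then show ?case by (simp add: summable_geometric)
next
  case (Suc n)
  have "summable (\<lambda>k. diffs (\<lambda>k. of_nat k ^ n) k * q ^ k)"
    using Suc by (intro termdiff_converges[where K = 1]) auto
  then have "summable (\<lambda>k. diffs (\<lambda>k. of_nat k ^ n) k * q ^ k * q)"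
    by (rule summable_mult2)
  then have "summable (\<lambda>k. of_nat (Suc k) ^ Suc n * q ^ Suc k)"
    by (simp add: diffs_def mult_ac)
  then show ?case by (subst (asm) summable_Suc_iff)
qed

text \<open>The operator q d/dq multiplies the k-th coefficient by k. Only \<open>q * D\<close> is
  described, since that product is what the chain rule produces for q = exp(2 pi i w).\<close>

lemma has_field_derivative_neg_polylog:
  assumes "norm q < 1"
  shows "\<exists>D. (neg_polylog n has_field_derivative D) (at q) \<and> q * D = neg_polylog (Suc n) q"
proof (intro exI conjI)
  let ?d = "\<lambda>k. diffs (\<lambda>k. of_nat k ^ n) k * q ^ k :: complex"
  show "(neg_polylog n has_field_derivative (\<Sum>k. ?d k)) (at q)"
    unfolding neg_polylog_def
    using assms by (intro termdiffs_strong'[where K = 1] summable_neg_polylog)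
  have "summable ?d"
    using assms by (intro termdiff_converges[where K = 1] summable_neg_polylog) auto
  then have "q * (\<Sum>k. ?d k) = (\<Sum>k. q * ?d k)" by (rule suminf_mult[symmetric])
  also have "\<dots> = (\<Sum>k. of_nat (Suc k) ^ Suc n * q ^ Suc k)" by (simp add: diffs_def mult_ac)
  also have "\<dots> = neg_polylog (Suc n) q"
    unfolding neg_polylog_def using suminf_split_head[OF summable_neg_polylog[OF assms, of "Suc n"]]
    by simp
  finally show "q * (\<Sum>k. ?d k) = neg_polylog (Suc n) q" .
qed

lemma neg_polylog_1:
  assumes "norm q < 1"
  shows "neg_polylog 1 q = q / (1 - q)\<^sup>2"
proof -
  have "(\<lambda>k. of_nat (Suc k) ^ 1 * q ^ Suc k) sums (1 / (1 - q)\<^sup>2 * q)"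
    using sums_mult2[OF geometric_deriv_sums[OF assms], of q] by (simp add: mult_ac)
  then have "(\<lambda>k. of_nat k ^ 1 * q ^ k) sums (1 / (1 - q)\<^sup>2 * q)"
    by (subst (asm) sums_Suc_iff) simp
  then show ?thesis by (simp add: neg_polylog_def sums_iff)
qed

section \<open>Reflection formulas in the upper half-plane\<close>

lemma not_nonpos_Int_if_Im_nonzero:
  fixes w :: complex
  assumes "Im w \<noteq> 0"
  shows "w \<notin> \<int>\<^sub>\<le>\<^sub>0"
  using assms by (auto elim!: nonpos_Ints_cases)

lemma sin_pi_nonzero_if_Im_nonzero:
  assumes "Im w \<noteq> 0"
  shows "sin (of_real pi * w) \<noteq> 0"
proof
  assume "sin (of_real pi * w) = 0"
  then obtain n :: int where "of_real pi * w = of_real (of_int n * pi)"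
    by (auto simp: sin_eq_0)
  then have "w = of_int n" by (simp add: field_simps)
  then show False using assms by simp
qed

text \<open>Differentiate Gamma(z) Gamma(1-z) = pi / sin(pi z) on both sides and cancel the common
  nonzero factor.\<close>

lemma Digamma_reflection:
  assumes "Im w > 0"
  shows "Digamma w - Digamma (1 - w) = - of_real pi * cos (of_real pi * w) / sin (of_real pi * w)"
proof -
  have w: "w \<notin> \<int>\<^sub>\<le>\<^sub>0" "1 - w \<notin> \<int>\<^sub>\<le>\<^sub>0" and s: "sin (of_real pi * w) \<noteq> 0"
    using assms by (auto intro!: not_nonpos_Int_if_Im_nonzero sin_pi_nonzero_if_Im_nonzero)
  have "((\<lambda>z. Gamma z * Gamma (1 - z)) has_field_derivative
         (Gamma w * Gamma (1 - w) * (Digamma w - Digamma (1 - w)))) (at w)"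
    using w by (auto intro!: derivative_eq_intros simp: algebra_simps)
  moreover have "((\<lambda>z. of_real pi / sin (of_real pi * z)) has_field_derivative
         (of_real pi / sin (of_real pi * w) * (- of_real pi * cos (of_real pi * w) / sin (of_real pi * w)))) (at w)"
    using s by (auto intro!: derivative_eq_intros simp: field_simps)
  ultimately have "Gamma w * Gamma (1 - w) * (Digamma w - Digamma (1 - w)) =
     of_real pi / sin (of_real pi * w) * (- of_real pi * cos (of_real pi * w) / sin (of_real pi * w))"
    unfolding Gamma_reflection_complex by (rule DERIV_unique)
  then show ?thesis
    unfolding Gamma_reflection_complex mult_cancel_left using s by simp
qed

text \<open>This is the derivative of the digamma reflection, which holds on the whole open
  half-plane and so determines derivatives there.\<close>

lemma Polygamma_1_reflection:
  assumes "Im w > 0"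
  shows "Polygamma 1 w + Polygamma 1 (1 - w) = (of_real pi / sin (of_real pi * w))\<^sup>2"
proof -
  let ?c = "\<lambda>z. - of_real pi * cos (of_real pi * z) / sin (of_real pi * z) :: complex"
  have w: "w \<notin> \<int>\<^sub>\<le>\<^sub>0" "1 - w \<notin> \<int>\<^sub>\<le>\<^sub>0" and s: "sin (of_real pi * w) \<noteq> 0"
    using assms by (auto intro!: not_nonpos_Int_if_Im_nonzero sin_pi_nonzero_if_Im_nonzero)
  have "((\<lambda>z. Digamma z - Digamma (1 - z)) has_field_derivative
         (Polygamma 1 w + Polygamma 1 (1 - w))) (at w)"
    using w by (auto intro!: derivative_eq_intros)
  then have "(?c has_field_derivative (Polygamma 1 w + Polygamma 1 (1 - w))) (at w)"
    by (rule has_field_derivative_transform_within_open[where S = "{z. Im z > 0}"])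
       (use assms in \<open>auto simp: Digamma_reflection open_halfspace_Im_gt\<close>)
  moreover have "((\<lambda>z. cot (of_real pi * z)) has_field_derivative
      - inverse ((sin (of_real pi * w))\<^sup>2) * of_real pi) (at w)"
    using s by (intro DERIV_chain2[where f = cot] DERIV_cot) (auto intro!: derivative_eq_intros)
  then have "((\<lambda>z. - of_real pi * cot (of_real pi * z)) has_field_derivative
      - of_real pi * (- inverse ((sin (of_real pi * w))\<^sup>2) * of_real pi)) (at w)"
    by (rule DERIV_cmult)
  then have "(?c has_field_derivative
      - of_real pi * (- inverse ((sin (of_real pi * w))\<^sup>2) * of_real pi)) (at w)"
    by (simp add: cot_def)
  ultimately have "Polygamma 1 w + Polygamma 1 (1 - w) =
      - of_real pi * (- inverse ((sin (of_real pi * w))\<^sup>2) * of_real pi)"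
    by (rule DERIV_unique)
  then show ?thesis
    by (simp add: power_divide power2_eq_square field_simps)
qed

lemma norm_exp_2pii_less_1:
  assumes "Im w > 0"
  shows "norm (exp (2 * of_real pi * \<i> * w)) < 1"
  using assms by simp

text \<open>The two polygamma values are, up to a common sign and factorial, the halves
  \<open>k \<ge> 0\<close> and \<open>k < 0\<close> of the sum of (w+k)^(-n-2) over all integers.
  The case \<open>n = 0\<close> is the trigamma reflection; each derivative in \<open>w\<close>
  yields a factor 2 pi i on the left and a sign change from 1 - w on the right.\<close>

lemma Lipschitz_formula:
  assumes "Im w > 0"
  shows "(2 * of_real pi * \<i>) ^ (n + 2) * neg_polylog (Suc n) (exp (2 * of_real pi * \<i> * w)) =
         Polygamma (Suc n) w + (-1) ^ n * Polygamma (Suc n) (1 - w)"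
  using assms
proof (induction n arbitrary: w)
  case 0
  \<comment> \<open>The half-angle exponential makes sin(pi w) rational in \<open>e\<close>, while
    the argument of the power series is \<open>e ^ 2\<close>.\<close>
  define e where "e = exp (of_real pi * \<i> * w)"
  have e: "e \<noteq> 0" "exp (2 * of_real pi * \<i> * w) = e ^ 2"
    by (simp_all add: e_def mult.assoc flip: exp_double)
  have lt: "norm (e ^ 2) < 1" using norm_exp_2pii_less_1[OF 0] e by simp
  then have ne: "1 - e ^ 2 \<noteq> 0" by auto
  have sin: "sin (of_real pi * w) = (e - 1 / e) / (2 * \<i>)"
    by (simp add: sin_exp_eq e_def exp_minus field_simps)
  have "Polygamma 1 w + Polygamma 1 (1 - w) = (of_real pi / sin (of_real pi * w))\<^sup>2"
    by (rule Polygamma_1_reflection[OF 0])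
  also have "\<dots> = (2 * of_real pi * \<i>) ^ 2 * (e ^ 2 / (1 - e ^ 2)\<^sup>2)"
    using e ne unfolding sin by (simp add: divide_simps power2_eq_square) (auto simp: algebra_simps)
  also have "e ^ 2 / (1 - e ^ 2)\<^sup>2 = neg_polylog 1 (exp (2 * of_real pi * \<i> * w))"
    using neg_polylog_1[OF lt] e by simp
  finally show ?case by (simp add: numeral_2_eq_2)
next
  case (Suc n)
  let ?q = "\<lambda>w. exp (2 * of_real pi * \<i> * w)" and ?c = "2 * of_real pi * \<i>"
  have w: "w \<notin> \<int>\<^sub>\<le>\<^sub>0" "1 - w \<notin> \<int>\<^sub>\<le>\<^sub>0"
    using Suc.prems by (auto intro!: not_nonpos_Int_if_Im_nonzero)
  obtain D where D: "(neg_polylog (Suc n) has_field_derivative D) (at (?q w))"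
    "?q w * D = neg_polylog (Suc (Suc n)) (?q w)"
    using has_field_derivative_neg_polylog[OF norm_exp_2pii_less_1[OF Suc.prems]] by blast
  have "((\<lambda>w. neg_polylog (Suc n) (?q w)) has_field_derivative D * (?c * ?q w)) (at w)"
    by (rule DERIV_chain2[where f = "neg_polylog (Suc n)" and g = ?q, OF D(1)]) (auto intro!: derivative_eq_intros)
  then have "((\<lambda>w. ?c ^ (n + 2) * neg_polylog (Suc n) (?q w)) has_field_derivative
              ?c ^ (n + 2) * (D * (?c * ?q w))) (at w)"
    by (rule DERIV_cmult)
  \<comment> \<open>The induction hypothesis identifies the two functions on an open set, so they
    share this derivative.\<close>
  then have "((\<lambda>w. Polygamma (Suc n) w + (-1) ^ n * Polygamma (Suc n) (1 - w)) has_field_derivative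
              ?c ^ (n + 2) * (D * (?c * ?q w))) (at w)"
    by (rule has_field_derivative_transform_within_open[where S = "{z. Im z > 0}"])
       (use Suc in \<open>auto simp: open_halfspace_Im_gt\<close>)
  moreover have "((\<lambda>w. Polygamma (Suc n) w + (-1) ^ n * Polygamma (Suc n) (1 - w)) has_field_derivative
      Polygamma (Suc (Suc n)) w + (-1) ^ Suc n * Polygamma (Suc (Suc n)) (1 - w)) (at w)"
    using w by (auto intro!: derivative_eq_intros)
  ultimately have "?c ^ (n + 2) * (D * (?c * ?q w)) =
      Polygamma (Suc (Suc n)) w + (-1) ^ Suc n * Polygamma (Suc (Suc n)) (1 - w)"
    by (rule DERIV_unique)
  moreover have "?c ^ (n + 2) * (D * (?c * ?q w)) = ?c ^ (Suc n + 2) * (?q w * D)"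
    by (simp only: power_Suc add_Suc) (simp only: mult_ac)
  ultimately show ?case using D(2) by simp
qed

section \<open>Continuation of the periodic zeta function\<close>

text \<open>For \<open>n > 0\<close> and \<open>x > 0\<close> this is the function phi_n of the
  overview.\<close>

definition mellin_kernel :: "nat \<Rightarrow> real \<Rightarrow> real \<Rightarrow> complex" where
  "mellin_kernel n a x = neg_polylog n (exp (2 * of_real pi * \<i> * of_real a - of_real x))"

text \<open>Only \<open>y > 0\<close> will occur: the poles of the kernel with negative imaginary
  part 2 pi (a - 1 - k) enter as complex conjugates of terms with y = 2 pi (1 - a + k).\<close>

definition pole_term :: "nat \<Rightarrow> real \<Rightarrow> real \<Rightarrow> complex" where
  "pole_term n y x = inverse ((of_real x - \<i> * of_real y) ^ Suc n)"

text \<open>The modulus of x - iy is at least that of its imaginary part. The bound does not depend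
  on \<open>x\<close>, which keeps the sum over the poles bounded as x tends to 0.\<close>

lemma norm_pole_term_le:
  assumes "y > 0"
  shows "norm (pole_term n y x) \<le> inverse (y ^ Suc n)"
proof -
  have "y \<le> norm (of_real x - \<i> * of_real y)"
    using abs_Im_le_cmod[of "of_real x - \<i> * of_real y"] assms by simp
  then have "y ^ Suc n \<le> norm (of_real x - \<i> * of_real y) ^ Suc n"
    using assms by (intro power_mono) auto
  then show ?thesis
    using assms unfolding pole_term_def by (subst norm_inverse, subst norm_power) (intro le_imp_inverse_le, auto)
qed

lemma summable_inverse_shift_power:
  fixes b :: real
  assumes "b > 0" "n > 0"
  shows "summable (\<lambda>k. inverse ((2 * pi * (b + of_nat k)) ^ Suc n))"
proof -
  have "summable (\<lambda>k. inverse ((b + of_nat k) ^ Suc n))"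
    using assms by (intro Polygamma_converges') auto
  then have "summable (\<lambda>k. inverse ((2 * pi) ^ Suc n) * inverse ((b + of_nat k) ^ Suc n))"
    by (rule summable_mult)
  then show ?thesis by (simp only: power_mult_distrib inverse_mult_distrib)
qed

lemma summable_norm_pole_term:
  assumes "b > 0" "n > 0"
  shows "summable (\<lambda>k. norm (pole_term n (2 * pi * (b + of_nat k)) x))"
  by (rule summable_comparison_test'[OF summable_inverse_shift_power[OF assms], where N = 0])
     (use assms in \<open>auto intro!: norm_pole_term_le mult_pos_pos add_pos_nonneg simp del: power_Suc\<close>)

text \<open>This is the Lipschitz formula with each polygamma value expanded into its
  series.\<close>

lemma mellin_kernel_eq_pole_sum:
  assumes "0 < a" "a < 1" "x > 0" "n > 0"
  shows "mellin_kernel n a x = fact n * ((\<Sum>k. pole_term n (2 * pi * (a + of_nat k)) x) +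
           cnj (\<Sum>k. pole_term n (2 * pi * (1 - a + of_nat k)) x))"
proof -
  let ?c = "2 * of_real pi * \<i> :: complex"
  obtain m where n: "n = Suc m" using assms(4) by (cases n) auto
  \<comment> \<open>Chosen so that 2 pi i w = 2 pi i a - x; positivity of \<open>x\<close> puts
    \<open>w\<close> in the upper half-plane.\<close>
  define w where "w = of_real a + \<i> * of_real (x / (2 * pi))"
  have Im: "Im w > 0" using assms by (simp add: w_def)
  have cw: "?c * w = ?c * of_real a - of_real x" by (simp add: w_def algebra_simps)
  have w0: "w \<noteq> 0" "1 - w \<noteq> 0" using Im by (auto simp: complex_eq_iff)
  have "(\<lambda>k. pole_term n (2 * pi * (a + of_nat k)) x) sums
      (inverse (?c ^ Suc n) * (Polygamma n w / fact n))"
  proof -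
    have "pole_term n (2 * pi * (a + of_nat k)) x =
        inverse ((- ?c) ^ Suc n) * inverse ((w + of_nat k) ^ Suc n)" for k
    proof -
      have "of_real x - \<i> * of_real (2 * pi * (a + of_nat k)) = - ?c * (w + of_nat k)"
        using cw by (simp add: algebra_simps)
      then show ?thesis unfolding pole_term_def by (simp only: power_mult_distrib inverse_mult_distrib)
    qed
    moreover have "(\<lambda>k. inverse ((- ?c) ^ Suc n) * inverse ((w + of_nat k) ^ Suc n)) sums
      (inverse ((- ?c) ^ Suc n) * ((-1) ^ Suc n * Polygamma n w / fact n))"
      using w0 assms(4) by (intro sums_mult Polygamma_LIMSEQ) auto
    \<comment> \<open>The sign of the polygamma series cancels the sign from (-2 pi
      i)^(n+1).\<close>
    moreover have "inverse ((- ?c) ^ Suc n) * ((-1) ^ Suc n * Polygamma n w / fact n) =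
       inverse (?c ^ Suc n) * (Polygamma n w / fact n)"
      by (subst power_minus) (simp add: power_mult_distrib)
    ultimately show ?thesis by (simp only:)
  qed
  then have s1: "(\<Sum>k. pole_term n (2 * pi * (a + of_nat k)) x) = inverse (?c ^ Suc n) * (Polygamma n w / fact n)"
    by (rule sums_unique[symmetric])
  have "(\<lambda>k. cnj (pole_term n (2 * pi * (1 - a + of_nat k)) x)) sums
      (inverse (?c ^ Suc n) * ((-1) ^ Suc n * Polygamma n (1 - w) / fact n))"
  proof -
    have "cnj (pole_term n (2 * pi * (1 - a + of_nat k)) x) =
        inverse (?c ^ Suc n) * inverse ((1 - w + of_nat k) ^ Suc n)" for k
    proof -
      have "of_real x + \<i> * of_real (2 * pi * (1 - a + of_nat k)) = ?c * (1 - w + of_nat k)"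
        using cw by (simp add: algebra_simps)
      moreover have "cnj (pole_term n y x) = inverse ((of_real x + \<i> * of_real y) ^ Suc n)" for y
        by (simp add: pole_term_def)
      ultimately show ?thesis by (simp only: power_mult_distrib inverse_mult_distrib)
    qed
    then show ?thesis
      using sums_mult[OF Polygamma_LIMSEQ[OF w0(2) assms(4)], of "inverse (?c ^ Suc n)"] by (simp only:)
  qed
  then have s2: "cnj (\<Sum>k. pole_term n (2 * pi * (1 - a + of_nat k)) x) =
      inverse (?c ^ Suc n) * ((-1) ^ Suc n * Polygamma n (1 - w) / fact n)"
    using summable_norm_cancel[OF summable_norm_pole_term[of "1 - a" n x]] assms
    by (subst bounded_linear.suminf[OF bounded_linear_cnj]) (auto simp: sums_iff)
  \<comment> \<open>Here n = m + 1, so the exponents \<open>m\<close> and \<open>Suc n\<close> have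
    the same parity and the sign agrees with that of the second pole sum.\<close>
  have "?c ^ Suc n * mellin_kernel n a x = Polygamma n w + (-1) ^ m * Polygamma n (1 - w)"
    using Lipschitz_formula[OF Im, of m] by (simp add: mellin_kernel_def cw n)
  moreover have "mellin_kernel n a x = inverse (?c ^ Suc n) * (?c ^ Suc n * mellin_kernel n a x)"
  proof -
    have "?c ^ Suc n \<noteq> 0" by simp
    from left_inverse[OF this] show ?thesis by (simp only: mult.assoc[symmetric] mult_1_left)
  qed
  ultimately have "mellin_kernel n a x = inverse (?c ^ Suc n) * (Polygamma n w + (-1) ^ Suc n * Polygamma n (1 - w))"
    by (simp only: n) simp
  moreover have "fact n * (z * (u / fact n) + z * (v / fact n)) = z * (u + v)" for z u v :: complex
    by (simp add: field_simps)
  ultimately show ?thesis unfolding s1 s2 by (simp only:)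
qed

section \<open>Size and measurability of the kernel\<close>

lemma norm_exp_kernel_arg: "norm (exp (2 * of_real pi * \<i> * of_real a - of_real x :: complex)) = exp (- x)"
  by simp

text \<open>The pole expansion bounds the kernel by a constant for all \<open>x > 0\<close>, and the
  power series gives exponential decay for \<open>x \<ge> 1\<close>. The first handles
  \<open>x < 1\<close>, where e^(-x) is bounded below.\<close>

lemma mellin_kernel_bound:
  assumes "0 < a" "a < 1" "n > 0"
  obtains C where "\<And>x. x > 0 \<Longrightarrow> norm (mellin_kernel n a x) \<le> C * exp (- x)"
proof -
  define S where "S = (\<lambda>b. \<Sum>k. inverse ((2 * pi * (b + of_nat k)) ^ Suc n))"
  define B where "B = fact n * (S a + S (1 - a))"
  \<comment> \<open>The majorant at x = 1: for \<open>x \<ge> 1\<close> one factor e^(-x) is split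
    off each term and the other k - 1 are bounded by e^(-1), at the cost of a factor e.\<close>
  define E where "E = (\<Sum>k. of_nat k ^ n * exp (- 1) ^ k :: real)"
  have pole: "norm (\<Sum>k. pole_term n (2 * pi * (b + of_nat k)) x) \<le> S b" if "b > 0" for b x
  proof -
    have "norm (\<Sum>k. pole_term n (2 * pi * (b + of_nat k)) x) \<le> (\<Sum>k. norm (pole_term n (2 * pi * (b + of_nat k)) x))"
      using that assms(3) by (intro summable_norm summable_norm_pole_term)
    also have "\<dots> \<le> S b"
      unfolding S_def using that assms(3)
      by (intro suminf_le summable_norm_pole_term summable_inverse_shift_power norm_pole_term_le)
         (auto intro!: mult_pos_pos add_pos_nonneg)
    finally show ?thesis .
  qed
  have E_sum: "summable (\<lambda>k. of_nat k ^ n * exp (- 1) ^ k :: real)"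
    by (rule summable_neg_polylog) simp
  have E0: "E \<ge> 0" unfolding E_def by (intro suminf_nonneg E_sum) auto
  have B0: "B \<ge> 0"
    using order_trans[OF norm_ge_zero pole[of a]] order_trans[OF norm_ge_zero pole[of "1 - a"]] assms
    by (auto simp: B_def)
  have near: "norm (mellin_kernel n a x) \<le> B" if "x > 0" for x
  proof -
    have "norm (mellin_kernel n a x) \<le> fact n * (norm (\<Sum>k. pole_term n (2 * pi * (a + of_nat k)) x) +
             norm (cnj (\<Sum>k. pole_term n (2 * pi * (1 - a + of_nat k)) x)))"
      unfolding mellin_kernel_eq_pole_sum[OF assms(1,2) that assms(3)] norm_mult norm_fact
      by (intro mult_left_mono norm_triangle_ineq) auto
    also have "\<dots> \<le> B"
      unfolding B_def complex_mod_cnj using assms by (intro mult_left_mono add_mono pole) auto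
    finally show ?thesis .
  qed
  have far: "norm (mellin_kernel n a x) \<le> exp 1 * E * exp (- x)" if "x \<ge> 1" for x
  proof -
    let ?q = "exp (2 * of_real pi * \<i> * of_real a - of_real x) :: complex"
    have tm: "norm (of_nat k ^ n * ?q ^ k) \<le> exp 1 * exp (- x) * (of_nat k ^ n * exp (- 1) ^ k)" for k
    proof (cases k)
      case 0
      \<comment> \<open>No factor can be split off for \<open>k = 0\<close>, but this term is zero
        because \<open>n > 0\<close>.\<close>
      then show ?thesis using assms(3) by (simp add: power_0_left)
    next
      case (Suc j)
      have "exp (- x) ^ k = exp (- x) * exp (- x) ^ j" using Suc by simp
      also have "\<dots> \<le> exp (- x) * exp (- 1) ^ j"
        using that by (intro mult_left_mono power_mono) auto
      also have "exp (- 1) ^ j = exp 1 * exp (- 1 :: real) ^ k"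
        unfolding Suc power_Suc by (simp add: exp_minus)
      finally have "of_nat k ^ n * exp (- x) ^ k \<le> of_nat k ^ n * (exp (- x) * (exp 1 * exp (- 1) ^ k))"
        by (intro mult_left_mono) auto
      then show ?thesis
        unfolding norm_mult norm_power norm_of_nat norm_exp_kernel_arg by (simp only: mult_ac)
    qed
    have "norm (mellin_kernel n a x) \<le> (\<Sum>k. exp 1 * exp (- x) * (of_nat k ^ n * exp (- 1) ^ k))"
      unfolding mellin_kernel_def neg_polylog_def
      by (rule norm_suminf_le[OF tm summable_mult[OF E_sum]])
    also have "\<dots> = exp 1 * exp (- x) * E"
      unfolding E_def by (rule suminf_mult[OF E_sum])
    finally show ?thesis by (simp add: mult_ac)
  qed
  have "norm (mellin_kernel n a x) \<le> exp 1 * (B + E) * exp (- x)" if x: "x > 0" for x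
  proof (cases "x \<ge> 1")
    case True
    have "norm (mellin_kernel n a x) \<le> exp 1 * E * exp (- x)" by (rule far[OF True])
    also have "\<dots> \<le> exp 1 * (B + E) * exp (- x)" using B0 by (intro mult_right_mono mult_left_mono) auto
    finally show ?thesis .
  next
    case False
    have "norm (mellin_kernel n a x) \<le> (B + E) * 1" using near[OF x] E0 by simp
    also have "\<dots> \<le> (B + E) * (exp 1 * exp (- x))"
      using False B0 E0 by (intro mult_left_mono) (auto simp flip: exp_add)
    finally show ?thesis by (simp add: mult_ac)
  qed
  then show ?thesis by (rule that)
qed

lemma borel_measurable_mellin_kernel: "mellin_kernel n a \<in> borel_measurable halfline"
proof (rule borel_measurable_halfline)
  let ?q = "\<lambda>x. exp (2 * of_real pi * \<i> * of_real a - of_real x) :: complex"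
  have "continuous_on (ball 0 1) (neg_polylog n)"
  proof (intro continuous_at_imp_continuous_on ballI)
    fix q :: complex assume "q \<in> ball 0 1"
    then show "isCont (neg_polylog n) q"
      using has_field_derivative_neg_polylog[of q n] DERIV_isCont by auto
  qed
  moreover have "continuous_on {0<..} ?q" by (intro continuous_intros)
  moreover have "?q ` {0<..} \<subseteq> ball 0 1" by auto
  ultimately show "continuous_on {0<..} (mellin_kernel n a)"
    unfolding mellin_kernel_def by (rule continuous_on_compose2[where g = "neg_polylog n" and f = ?q])
qed

text \<open>Multiplying by the entire function \<open>rGamma\<close>, instead of dividing by
  \<open>Gamma\<close>, leaves only the integral to restrict the domain, to Re s > -n.\<close>

definition periodic_zeta_rep :: "nat \<Rightarrow> real \<Rightarrow> complex \<Rightarrow> complex" where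
  "periodic_zeta_rep n a s =
     rGamma (s + of_nat n) * (\<integral>x. of_real x powr (s + of_nat n - 1) * mellin_kernel n a x \<partial>halfline)"

section \<open>The Mellin representations continue the Dirichlet series\<close>

lemma holomorphic_periodic_zeta_rep:
  assumes "0 < a" "a < 1" "n > 0"
  shows "periodic_zeta_rep n a holomorphic_on {s. Re s > - of_nat n}"
proof -
  let ?M = "\<lambda>s. \<integral>x. of_real x powr (s - 1) * mellin_kernel n a x \<partial>halfline"
  obtain C where "\<And>x. x > 0 \<Longrightarrow> norm (mellin_kernel n a x) \<le> C * exp (- x)"
    using mellin_kernel_bound[OF assms] by blast
  from holomorphic_Mellin[OF borel_measurable_mellin_kernel this]
  have M: "?M holomorphic_on {s. Re s > 0}" .
  have "(?M \<circ> (\<lambda>s. s + of_nat n)) holomorphic_on {s. Re s > - of_nat n}"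
    by (intro holomorphic_on_compose_gen[OF _ M] holomorphic_intros) auto
  then show ?thesis
    unfolding periodic_zeta_rep_def [abs_def] comp_def by (intro holomorphic_intros)
qed

text \<open>Integrating z^k k^n e^(-kx) against x^(s+n-1) gives Gamma(s+n) z^k k^(-s). Sum and
  integral may be exchanged since the integrals of the norms add up to Gamma(Re s + n) times a
  convergent sum of k^(-Re s).\<close>

lemma periodic_zeta_term_sums_rep:
  assumes "Re s > 1" "n > 0"
  shows "periodic_zeta_term a s sums periodic_zeta_rep n a s"
proof -
  let ?q = "\<lambda>x. exp (2 * of_real pi * \<i> * of_real a - of_real x) :: complex"
  let ?z = "\<lambda>k. exp (2 * of_real pi * \<i> * of_nat (Suc k) * of_real a) :: complex"
  define f where "f = (\<lambda>k x. of_real x powr (s + of_nat n - 1) * (of_nat (Suc k) ^ n * ?q x ^ Suc k))"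
  have sn: "Re (s + of_nat n) > 0" using assms by simp
  have G: "Gamma (s + of_nat n) \<noteq> 0"
  proof -
    have "s + of_nat n \<notin> \<int>\<^sub>\<le>\<^sub>0"
    proof
      assume "s + of_nat n \<in> \<int>\<^sub>\<le>\<^sub>0"
      then obtain m :: int where "s + of_nat n = of_int m" "m \<le> 0" by (elim nonpos_Ints_cases)
      then have "Re (s + of_nat n) \<le> 0" by simp
      then show False using sn by simp
    qed
    then show ?thesis by (simp add: Gamma_eq_zero_iff)
  qed
  have f_eq: "f k x = of_nat (Suc k) ^ n * ?z k *
      (of_real x powr (s + of_nat n - 1) * exp (- of_real (of_nat (Suc k) * x)))" for k x
  proof -
    have "?q x ^ Suc k = exp (of_nat (Suc k) * (2 * of_real pi * \<i> * of_real a - of_real x))"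
      by (rule exp_of_nat_mult[symmetric])
    also have "of_nat (Suc k) * (2 * of_real pi * \<i> * of_real a - of_real x) =
      2 * of_real pi * \<i> * of_nat (Suc k) * of_real a + - of_real (of_nat (Suc k) * x)"
      by (simp add: algebra_simps)
    finally show ?thesis unfolding f_def exp_add by (simp only: mult_ac)
  qed
  have int: "has_bochner_integral halfline (f k) (Gamma (s + of_nat n) * periodic_zeta_term a s k)" for k
  proof -
    have "has_bochner_integral halfline (f k) (of_nat (Suc k) ^ n * ?z k *
       (Gamma (s + of_nat n) * of_real (of_nat (Suc k)) powr (- (s + of_nat n))))"
      unfolding f_eq[abs_def] using sn by (intro has_bochner_integral_mult_right has_bochner_integral_Gamma) auto
    moreover have "of_real (of_nat (Suc k)) powr (- (s + of_nat n)) * (of_nat (Suc k) ^ n) = (of_nat (Suc k) powr (- s) :: complex)"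
      unfolding minus_add_distrib powr_add powr_minus of_real_of_nat_eq
      by (simp add: powr_nat del: of_nat_Suc)
    moreover have "of_nat (Suc k) ^ n * ?z k *
        (Gamma (s + of_nat n) * of_real (of_nat (Suc k)) powr (- (s + of_nat n))) =
        Gamma (s + of_nat n) * (?z k * (of_real (of_nat (Suc k)) powr (- (s + of_nat n)) * (of_nat (Suc k) ^ n)))"
      by (simp only: mult_ac)
    ultimately show ?thesis
      unfolding periodic_zeta_term_def by (simp only:)
  qed
  have norm_f: "norm (f k x) = of_nat (Suc k) ^ n * (x powr (Re s + of_nat n - 1) * exp (- (of_nat (Suc k) * x)))"
    if "x > 0" for k x
  proof -
    have "norm (?z k) = 1" by simp
    then show ?thesis
      using that unfolding f_eq by (simp add: norm_mult norm_power norm_powr_real_powr del: of_nat_Suc)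
  qed
  have nint: "(\<integral>x. norm (f k x) \<partial>halfline) = Gamma (Re s + of_nat n) * of_nat (Suc k) powr (- Re s)" for k
  proof -
    have "(\<integral>x. norm (f k x) \<partial>halfline) =
       (\<integral>x. of_nat (Suc k) ^ n * (x powr (Re s + of_nat n - 1) * exp (- (of_nat (Suc k) * x))) \<partial>halfline)"
      by (intro Bochner_Integration.integral_cong refl norm_f) (simp add: space_restrict_space)
    also have "\<dots> = of_nat (Suc k) ^ n * (Gamma (Re s + of_nat n) * of_nat (Suc k) powr (- (Re s + of_nat n)))"
      using sn by (intro has_bochner_integral_integral_eq has_bochner_integral_mult_right has_bochner_integral_Gamma_real) auto
    also have "of_nat (Suc k) powr (- (Re s + of_nat n)) = of_nat (Suc k) powr (- Re s) / (of_nat (Suc k) ^ n :: real)"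
      unfolding minus_add_distrib powr_add by (simp add: powr_minus powr_realpow divide_inverse del: of_nat_Suc)
    finally show ?thesis by (simp del: of_nat_Suc)
  qed
  have "(\<lambda>k. integral\<^sup>L halfline (f k)) sums (\<integral>x. (\<Sum>k. f k x) \<partial>halfline)"
  proof (rule sums_integral)
    show "integrable halfline (f k)" for k using int by (simp add: has_bochner_integral_iff)
    have "summable (\<lambda>k. norm (f k x))" if x: "x > 0" for x
    proof -
      have "summable (\<lambda>k. of_nat k ^ n * exp (- x) ^ k)"
        using x by (intro summable_neg_polylog) auto
      then have "summable (\<lambda>k. of_nat (Suc k) ^ n * exp (- x) ^ Suc k)"
        by (subst summable_Suc_iff)
      then have "summable (\<lambda>k. norm (of_real x powr (s + of_nat n - 1)) * (of_nat (Suc k) ^ n * exp (- x) ^ Suc k))"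
        by (rule summable_mult)
      then show ?thesis
        unfolding f_def norm_mult norm_power norm_of_nat norm_exp_kernel_arg .
    qed
    then show "AE x in halfline. summable (\<lambda>k. norm (f k x))"
      by (intro AE_I2) (simp add: space_restrict_space)
    have "summable (\<lambda>k. of_nat k powr (- Re s) :: real)"
      using assms by (simp add: summable_real_powr_iff)
    then have "summable (\<lambda>k. of_nat (Suc k) powr (- Re s) :: real)"
      by (subst summable_Suc_iff)
    then show "summable (\<lambda>k. \<integral>x. norm (f k x) \<partial>halfline)"
      unfolding nint by (rule summable_mult)
  qed
  also have "(\<lambda>k. integral\<^sup>L halfline (f k)) = (\<lambda>k. Gamma (s + of_nat n) * periodic_zeta_term a s k)"
    using int by (simp add: has_bochner_integral_iff)
  finally have "(\<lambda>k. rGamma (s + of_nat n) * (Gamma (s + of_nat n) * periodic_zeta_term a s k)) sums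
     (rGamma (s + of_nat n) * (\<integral>x. (\<Sum>k. f k x) \<partial>halfline))"
    by (rule sums_mult)
  also have "(\<lambda>k. rGamma (s + of_nat n) * (Gamma (s + of_nat n) * periodic_zeta_term a s k)) = periodic_zeta_term a s"
    using G by (simp add: rGamma_inverse_Gamma flip: mult.assoc)
  also have "(\<integral>x. (\<Sum>k. f k x) \<partial>halfline) =
     (\<integral>x. of_real x powr (s + of_nat n - 1) * mellin_kernel n a x \<partial>halfline)"
  proof (rule Bochner_Integration.integral_cong[OF refl])
    fix x assume "x \<in> space halfline"
    then have "norm (?q x) < 1" by (simp add: space_restrict_space)
    note sm = summable_neg_polylog[OF this, of n]
    \<comment> \<open>The term at index 0 vanishes because \<open>n > 0\<close>, so the index may be
      shifted to match the Dirichlet series.\<close>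
    have "mellin_kernel n a x = (\<Sum>k. of_nat (Suc k) ^ n * ?q x ^ Suc k)"
      unfolding mellin_kernel_def neg_polylog_def using suminf_split_head[OF sm] assms(2) by simp
    moreover have "summable (\<lambda>k. of_nat (Suc k) ^ n * ?q x ^ Suc k)"
      using sm by (subst summable_Suc_iff)
    ultimately show "(\<Sum>k. f k x) = of_real x powr (s + of_nat n - 1) * mellin_kernel n a x"
      unfolding f_def by (simp only: suminf_mult)
  qed
  finally show ?thesis by (simp add: periodic_zeta_rep_def)
qed

text \<open>Both representations equal the series for Re s > 1; the identity theorem extends this to
  the smaller of the two half-planes.\<close>

lemma periodic_zeta_rep_eq:
  assumes "0 < a" "a < 1" "m > 0" "n > 0" "Re s > - of_nat m" "Re s > - of_nat n"
  shows "periodic_zeta_rep m a s = periodic_zeta_rep n a s"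
proof (rule analytic_continuation_open[where s = "{s. Re s > 1}" and s' = "{s. Re s > - of_nat (min m n)}"
      and f = "periodic_zeta_rep m a" and g = "periodic_zeta_rep n a"])
  show "{s. Re s > 1} \<noteq> {}" by (auto intro!: exI[of _ 2])
  show "connected {s. Re s > - of_nat (min m n)}"
    by (intro convex_connected convex_halfspace_Re_gt)
  show "periodic_zeta_rep m a z = periodic_zeta_rep n a z" if "z \<in> {s. Re s > 1}" for z
    using periodic_zeta_term_sums_rep[of z] assms that by (blast intro: sums_unique2)
  show "periodic_zeta_rep m a holomorphic_on {s. Re s > - of_nat (min m n)}"
    using assms by (intro holomorphic_on_subset[OF holomorphic_periodic_zeta_rep]) auto
  show "periodic_zeta_rep n a holomorphic_on {s. Re s > - of_nat (min m n)}"
    using assms by (intro holomorphic_on_subset[OF holomorphic_periodic_zeta_rep]) auto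
qed (use assms in \<open>auto simp: min_def open_halfspace_Re_gt\<close>)

text \<open>The representations are compatible and their half-planes exhaust the plane, so they glue
  to an entire function, which uniqueness identifies with \<open>periodic_zeta a\<close>.\<close>

lemma periodic_zeta_eq_rep:
  assumes "0 < a" "a < 1" "n > 0" "Re s > - of_nat n"
  shows "periodic_zeta a s = periodic_zeta_rep n a s"
proof -
  define N where "N = (\<lambda>s :: complex. Suc (nat \<lceil>- Re s\<rceil>))"
  define f where "f = (\<lambda>s. periodic_zeta_rep (N s) a s)"
  have N: "N s > 0" "Re s > - of_nat (N s)" for s
  proof -
    show "N s > 0" by (simp add: N_def)
    have "- Re s \<le> of_nat (nat \<lceil>- Re s\<rceil>)" by (rule real_nat_ceiling_ge)
    then show "Re s > - of_nat (N s)" by (simp add: N_def)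
  qed
  have f: "f s = periodic_zeta_rep n a s" if "n > 0" "Re s > - of_nat n" for n s
    unfolding f_def by (intro periodic_zeta_rep_eq assms N that)
  have "f field_differentiable at s" for s
  proof -
    have "periodic_zeta_rep (N s) a field_differentiable at s"
      using N[of s] by (intro holomorphic_on_imp_differentiable_at[OF holomorphic_periodic_zeta_rep] assms)
         (auto simp: open_halfspace_Re_gt)
    then obtain D where "(periodic_zeta_rep (N s) a has_field_derivative D) (at s)"
      by (auto simp: field_differentiable_def)
    \<comment> \<open>The index \<open>N s\<close> stays fixed here: near \<open>s\<close> the glued
      function coincides with this single representation.\<close>
    then have "(f has_field_derivative D) (at s)"
      by (rule has_field_derivative_transform_within_open[where S = "{z. Re z > - of_nat (N s)}"])
         (use N[of s] f in \<open>auto simp: open_halfspace_Re_gt\<close>)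
    then show ?thesis by (auto simp: field_differentiable_def)
  qed
  then have "f holomorphic_on UNIV" by (simp add: holomorphic_on_def)
  moreover have "periodic_zeta_term a s sums f s" if "Re s > 1" for s
    using periodic_zeta_term_sums_rep[OF that, of 1 a] f[of 1 s] that by simp
  ultimately have "periodic_zeta a = f"
    by (intro periodic_zeta_eqI) (simp add: is_periodic_zeta_def)
  then show ?thesis using f[OF assms(3,4)] by simp
qed

section \<open>Non-vanishing for arguments greater than $-1$\<close>

text \<open>If the integral were zero, the positive integrand would vanish almost everywhere, making
  (0,1) a null set.\<close>

lemma integral_halfline_pos:
  fixes f :: "real \<Rightarrow> real"
  assumes "integrable halfline f" "\<And>x. x > 0 \<Longrightarrow> f x > 0"
  shows "(\<integral>x. f x \<partial>halfline) > 0"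
proof -
  have nn: "AE x in halfline. 0 \<le> f x"
    using assms(2) by (intro AE_I2) (auto simp: space_restrict_space intro: less_imp_le)
  have "(\<integral>x. f x \<partial>halfline) \<noteq> 0"
  proof
    assume "(\<integral>x. f x \<partial>halfline) = 0"
    then have "AE x in halfline. f x = 0"
      using integral_nonneg_eq_0_iff_AE[OF assms(1) nn] by simp
    then have "AE x in halfline. False"
      by (rule AE_mp, intro AE_I2) (use assms(2) in \<open>fastforce simp: space_restrict_space\<close>)
    then have "AE x in lborel. (x::real) \<in> {0<..} \<longrightarrow> False"
      by (subst (asm) AE_restrict_space_iff) auto
    then have "AE x in lborel. x \<notin> {0<..<1::real}"
      by (rule eventually_mono) auto
    then have "{0<..<1::real} \<in> null_sets lborel"
      by (subst AE_iff_null_sets) auto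
    then show False by (simp add: null_sets_def)
  qed
  then show ?thesis using integral_nonneg_AE[OF nn] by linarith
qed

text \<open>Expand by the conjugate of the denominator: q conj(1-q)^2 = q - 2|q|^2 + |q|^2
  conj(q).\<close>

lemma Im_div_one_minus_squared:
  fixes q :: complex
  shows "Im (q / (1 - q)\<^sup>2) = Im q * (1 - (norm q)\<^sup>2) / norm (1 - q) ^ 4"
proof -
  have "Im (q * cnj ((1 - q)\<^sup>2)) = Im q * (1 - (norm q)\<^sup>2)"
    unfolding cmod_power2 by (simp add: power2_eq_square algebra_simps)
  then show ?thesis
    by (simp add: complex_div_cnj[of q] norm_power flip: power_mult of_real_power)
qed

lemma Im_mellin_kernel_1:
  assumes "x > 0"
  obtains c where "c > 0" "Im (mellin_kernel 1 a x) = sin (2 * pi * a) * c"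
proof -
  define q :: complex where "q = exp (2 * of_real pi * \<i> * of_real a - of_real x)"
  have n: "norm q < 1" "norm q > 0" using assms by (simp_all add: q_def)
  have "Im (mellin_kernel 1 a x) = Im q * (1 - (norm q)\<^sup>2) / norm (1 - q) ^ 4"
    unfolding mellin_kernel_def q_def[symmetric] neg_polylog_1[OF n(1)] by (rule Im_div_one_minus_squared)
  also have "Im q = exp (- x) * sin (2 * pi * a)"
    by (simp add: q_def Im_exp)
  finally have "Im (mellin_kernel 1 a x) = sin (2 * pi * a) * (exp (- x) * (1 - (norm q)\<^sup>2) / norm (1 - q) ^ 4)"
    by simp
  moreover have "exp (- x) * (1 - (norm q)\<^sup>2) / norm (1 - q) ^ 4 > 0"
    using n by (auto intro!: divide_pos_pos mult_pos_pos zero_less_power simp: abs_square_less_1)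
  ultimately show ?thesis by (intro that)
qed

lemma rGamma_pos_real_nonzero:
  assumes "p > 0"
  shows "rGamma (of_real p :: complex) \<noteq> 0"
  using assms by (auto simp: rGamma_eq_zero_iff elim!: nonpos_Ints_cases dest: arg_cong[where f = Re])

text \<open>The power x^\<sigma> is real and positive, so the integrand's imaginary part has the
  same sign as that of the kernel, namely the constant sign of sin(2 pi a).\<close>

lemma periodic_zeta_nonzero_gt_minus1:
  assumes "0 < a" "a < 1" "a \<noteq> 1 / 2" "\<sigma> > -1"
  shows "periodic_zeta a (of_real \<sigma>) \<noteq> 0"
proof -
  let ?f = "\<lambda>x. complex_of_real x powr (of_real \<sigma> + of_nat 1 - 1) * mellin_kernel 1 a x"
  obtain C where C: "\<And>x. x > 0 \<Longrightarrow> norm (mellin_kernel 1 a x) \<le> C * exp (- x)"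
    using mellin_kernel_bound[OF assms(1,2) zero_less_one] by blast
  have int: "integrable halfline ?f"
    using assms by (intro integrable_Mellin[OF borel_measurable_mellin_kernel C]) auto
  have Im_f: "Im (?f x) = x powr \<sigma> * Im (mellin_kernel 1 a x)" if "x > 0" for x
    using that by (simp add: powr_of_real)
  have s: "sin (2 * pi * a) \<noteq> 0"
  proof
    assume "sin (2 * pi * a) = 0"
    then obtain i :: int where "2 * pi * a = of_int i * pi" by (auto simp: sin_zero_iff_int2)
    then have i: "2 * a = of_int i" by simp
    \<comment> \<open>A zero of the sine makes 2a an integer strictly between 0 and 2, which leaves
      only the excluded a = 1/2.\<close>
    then have "(0::real) < of_int i" "of_int i < (2::real)" using assms by linarith+
    then have "i = 1" by simp
    then show False using i assms(3) by simp
  qed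
  \<comment> \<open>The sign factor treats a < 1/2 and a > 1/2 together.\<close>
  have pos: "sgn (sin (2 * pi * a)) * Im (?f x) > 0" if x: "x > 0" for x
  proof -
    obtain c where c: "c > 0" "Im (mellin_kernel 1 a x) = sin (2 * pi * a) * c"
      using Im_mellin_kernel_1[OF x] by blast
    have "sgn (sin (2 * pi * a)) * Im (?f x) = x powr \<sigma> * c * \<bar>sin (2 * pi * a)\<bar>"
      unfolding Im_f[OF x] c(2) by (simp add: abs_sgn mult_ac)
    then show ?thesis using c(1) s x by simp
  qed
  have "(\<integral>x. sgn (sin (2 * pi * a)) * Im (?f x) \<partial>halfline) > 0"
    using int by (intro integral_halfline_pos integrable_mult_right integrable_Im pos)
  then have "Im (\<integral>x. ?f x \<partial>halfline) \<noteq> 0"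
    using integral_Im[OF int] by auto
  then have "(\<integral>x. ?f x \<partial>halfline) \<noteq> 0" by (metis zero_complex.sel(2))
  moreover have "rGamma (of_real \<sigma> + of_nat 1 :: complex) \<noteq> 0"
    using rGamma_pos_real_nonzero[of "\<sigma> + 1"] assms by simp
  moreover have "periodic_zeta a (of_real \<sigma>) = periodic_zeta_rep 1 a (of_real \<sigma>)"
    using assms by (intro periodic_zeta_eq_rep) auto
  ultimately show ?thesis by (simp add: periodic_zeta_rep_def)
qed

section \<open>Non-vanishing for negative arguments\<close>

text \<open>The integral J of the overview; for 0 < p < n + 1 it is the Beta value B(p, n+1-p) times
  (-i)^(p-n-1).\<close>

definition beta_integral :: "nat \<Rightarrow> real \<Rightarrow> complex" where
  "beta_integral n p = (\<integral>u. of_real (u powr (p - 1)) * pole_term n 1 u \<partial>halfline)"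

lemma borel_measurable_powr_pole_term:
  "(\<lambda>u. of_real (u powr p) * pole_term n y u) \<in> borel_measurable halfline"
  if "y \<noteq> 0"
proof -
  have "of_real u - \<i> * of_real y \<noteq> 0" for u
    using that by (auto simp: complex_eq_iff)
  then show ?thesis
    unfolding pole_term_def
    by (intro borel_measurable_halfline continuous_intros) auto
qed

text \<open>The majorant is a multiple of the derivative of (u/(1+u))^p, which rises from 0 to 1, so
  its integral is finite by the fundamental theorem of calculus.\<close>

lemma integrable_beta_integral:
  assumes "0 < p" "p \<le> of_nat n"
  shows "integrable halfline (\<lambda>u. of_real (u powr (p - 1)) * pole_term n 1 u)"
proof (rule Bochner_Integration.integrable_bound)
  define g where "g = (\<lambda>u. p * (u / (1 + u)) powr (p - 1) / (1 + u)\<^sup>2)"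
  have "set_integrable lborel (einterval (ereal 0) \<infinity>) g"
  proof (rule interval_integral_FTC_nonneg(1))
    let ?F = "\<lambda>u. (u / (1 + u)) powr p"
    show "DERIV ?F u :> g u" if "ereal 0 < ereal u" for u
      using that unfolding g_def
      by (auto intro!: derivative_eq_intros simp: powr_diff field_simps power2_eq_square)
    show "isCont g u" if "ereal 0 < ereal u" for u
      using that unfolding g_def by (auto intro!: continuous_intros)
    show "AE u in lborel. ereal 0 < ereal u \<longrightarrow> ereal u < \<infinity> \<longrightarrow> 0 \<le> g u"
      using assms by (auto simp: g_def intro!: AE_I2)
    have "(?F \<longlongrightarrow> 0) (at_right 0)" using assms(1) by real_asymp
    then show "((?F \<circ> real_of_ereal) \<longlongrightarrow> 0) (at_right (ereal 0))"
      by (simp add: ereal_tendsto_simps)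
    have "(?F \<longlongrightarrow> 1) at_top" by real_asymp
    then show "((?F \<circ> real_of_ereal) \<longlongrightarrow> 1) (at_left \<infinity>)"
      by (simp add: ereal_tendsto_simps)
  qed auto
  then show "integrable halfline (\<lambda>u. 2 ^ Suc n / p * g u)"
    by (intro integrable_mult_right) (simp add: set_integrable_def integrable_restrict_space)
  show "(\<lambda>u. of_real (u powr (p - 1)) * pole_term n 1 u) \<in> borel_measurable halfline"
    by (rule borel_measurable_powr_pole_term) simp
  have "norm (of_real (u powr (p - 1)) * pole_term n 1 u) \<le> norm (2 ^ Suc n / p * g u)" if u: "u > 0" for u
  proof -
    let ?r = "norm (of_real u - \<i> * of_real 1)"
    \<comment> \<open>The right-hand side is 4(1+u^2) - (1+u)^2, which compares 1 + u with twice |u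
      - i|.\<close>
    have "0 \<le> (1 - u)\<^sup>2 + 2 * (1 + u\<^sup>2)" by simp
    then have "(1 + u)\<^sup>2 \<le> 2\<^sup>2 * ?r\<^sup>2"
      unfolding cmod_power2 by (simp add: power2_eq_square algebra_simps)
    then have "(1 + u)\<^sup>2 \<le> (2 * ?r)\<^sup>2" by (simp add: power_mult_distrib)
    then have r: "1 + u \<le> 2 * ?r" by (rule power2_le_imp_le) simp
    have "(1 + u) powr (p + 1) \<le> (1 + u) powr (of_nat (Suc n))"
      using u assms(2) by (intro powr_mono) auto
    also have "\<dots> = (1 + u) ^ Suc n" using u by (subst powr_realpow) auto
    also have "\<dots> \<le> (2 * ?r) ^ Suc n" using u r by (intro power_mono) auto
    finally have le: "(1 + u) powr (p + 1) \<le> 2 ^ Suc n * ?r ^ Suc n" by (simp only: power_mult_distrib)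
    have r0: "?r > 0" using r u by linarith
    have "norm (of_real (u powr (p - 1)) * pole_term n 1 u) = u powr (p - 1) * (1 / ?r ^ Suc n)"
      unfolding pole_term_def norm_mult norm_inverse norm_power by (simp add: divide_inverse)
    also have "\<dots> \<le> u powr (p - 1) * (2 ^ Suc n / (1 + u) powr (p + 1))"
      using le r0 u by (intro mult_left_mono) (auto simp: divide_simps mult_ac simp del: power_Suc)
    also have "\<dots> = 2 ^ Suc n / p * g u"
    proof -
      have "(1 + u) powr (p + 1) = (1 + u) powr (p - 1) * (1 + u) powr 2"
        by (simp add: add.commute flip: powr_add)
      then show ?thesis
        using u assms(1) unfolding g_def by (simp add: powr_divide field_simps)
    qed
    also have "\<dots> \<le> norm (2 ^ Suc n / p * g u)" by (simp only: real_norm_def abs_ge_self)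
    finally show ?thesis .
  qed
  then show "AE u in halfline. norm (of_real (u powr (p - 1)) * pole_term n 1 u) \<le> norm (2 ^ Suc n / p * g u)"
    by (intro AE_I2) (simp add: space_restrict_space)
qed

text \<open>Integrate the derivative of u^p (u-i)^(-n-1), which tends to 0 at both ends, and rewrite
  u/(u-i) as 1 + i/(u-i).\<close>

lemma beta_integral_Suc:
  assumes "0 < p" "p \<le> of_nat n"
  shows "of_nat (Suc n) * \<i> * beta_integral (Suc n) p = of_real (p - of_nat (Suc n)) * beta_integral n p"
proof -
  let ?h = "\<lambda>n u. of_real (u powr (p - 1)) * pole_term n 1 u"
  define f where "f = (\<lambda>u. of_real (p - of_nat (Suc n)) * ?h n u - of_nat (Suc n) * \<i> * ?h (Suc n) u)"
  let ?F = "\<lambda>u. of_real (u powr p) * pole_term n 1 u"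
  have ne: "of_real u - \<i> \<noteq> (0::complex)" for u by (auto simp: complex_eq_iff)
  have int: "integrable halfline (?h n)" "integrable halfline (?h (Suc n))"
    using assms by (intro integrable_beta_integral; simp)+
  then have int_f: "integrable halfline f"
    unfolding f_def by (intro Bochner_Integration.integrable_diff integrable_mult_right)
  have "(LBINT u=ereal 0..\<infinity>. f u) = 0 - 0"
  proof (rule interval_integral_FTC_integrable)
    fix u assume "ereal 0 < ereal u"
    then have u: "u > 0" by simp
    have "((\<lambda>u. pole_term n 1 u) has_vector_derivative (- of_nat (Suc n) * pole_term (Suc n) 1 u)) (at u)"
    proof -
      have "((\<lambda>z. inverse ((z - \<i>) ^ Suc n)) has_field_derivative
              - of_nat (Suc n) * inverse ((of_real u - \<i>) ^ Suc (Suc n))) (at (of_real u))"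
      proof -
        have "((\<lambda>z. inverse (z - \<i>)) has_field_derivative - (inverse (of_real u - \<i>) ^ 2)) (at (of_real u))"
          using ne[of u] by (auto intro!: derivative_eq_intros simp: power2_eq_square)
        from DERIV_power[OF this, of "Suc n"] show ?thesis
          by (simp add: power_inverse power2_eq_square mult_ac del: of_nat_Suc)
      qed
      then have "((\<lambda>u. inverse ((of_real u - \<i>) ^ Suc n)) has_vector_derivative
              - of_nat (Suc n) * inverse ((of_real u - \<i>) ^ Suc (Suc n))) (at u)"
        by (rule has_vector_derivative_real_field)
      then show ?thesis unfolding pole_term_def by simp
    qed
    moreover have "((\<lambda>u. complex_of_real (u powr p)) has_vector_derivative of_real (p * u powr (p - 1))) (at u)"
      using u by (intro has_vector_derivative_of_real) (auto intro!: derivative_eq_intros simp flip: has_real_derivative_iff_has_vector_derivative)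
    ultimately have "(?F has_vector_derivative
        (of_real (u powr p) * (- of_nat (Suc n) * pole_term (Suc n) 1 u) + of_real (p * u powr (p - 1)) * pole_term n 1 u)) (at u)"
      by (rule has_vector_derivative_mult[rotated])
    also have "of_real (u powr p) * (- of_nat (Suc n) * pole_term (Suc n) 1 u) + of_real (p * u powr (p - 1)) * pole_term n 1 u = f u"
    proof -
      have "u powr p = u powr (p - 1) * u" using u by (simp add: powr_diff)
      moreover have "of_real u * pole_term (Suc n) 1 u = pole_term n 1 u + \<i> * pole_term (Suc n) 1 u"
      proof -
        let ?v = "of_real u - \<i> :: complex"
        have "?v * inverse (?v ^ Suc (Suc n)) = inverse (?v ^ Suc n)" using ne[of u] by simp
        moreover have "of_real u * z = ?v * z + \<i> * z" for z by (simp add: algebra_simps)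
        ultimately show ?thesis unfolding pole_term_def by simp
      qed
      ultimately have "of_real (u powr p) * pole_term (Suc n) 1 u =
         of_real (u powr (p - 1)) * (pole_term n 1 u + \<i> * pole_term (Suc n) 1 u)"
        by (metis mult.assoc of_real_mult)
      then show ?thesis unfolding f_def by (simp add: algebra_simps del: of_nat_Suc)
    qed
    finally show "(?F has_vector_derivative f u) (at u)" .
    show "isCont f u"
      using u ne unfolding f_def pole_term_def by (auto intro!: continuous_intros)
  next
    show "set_integrable lborel (einterval (ereal 0) \<infinity>) f"
      using int_f by (simp add: set_integrable_def integrable_restrict_space)
    have bound: "norm (?F u) \<le> u powr p" for u
      using norm_pole_term_le[of 1 n u] mult_left_le[of "norm (pole_term n 1 u)" "u powr p"] by (simp add: norm_mult)
    have "((\<lambda>u. u powr p) \<longlongrightarrow> 0) (at_right 0)" using assms(1) by real_asymp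
    then have "(?F \<longlongrightarrow> 0) (at_right 0)"
      by (rule Lim_null_comparison[rotated]) (use bound in auto)
    then show "((?F \<circ> real_of_ereal) \<longlongrightarrow> 0) (at_right (ereal 0))"
      by (simp add: ereal_tendsto_simps)
    \<comment> \<open>At infinity |u - i| \<ge> u gives a negative exponent because
      \<open>p \<le> n\<close>; near 0 the bound |u - i| \<ge> 1 was used instead.\<close>
    have bound': "norm (?F u) \<le> u powr (p - of_nat (Suc n))" if u: "u > 0" for u
    proof -
      have "u ^ Suc n \<le> norm (of_real u - \<i>) ^ Suc n"
        using u abs_Re_le_cmod[of "of_real u - \<i>"] by (intro power_mono) auto
      then have "norm (pole_term n 1 u) \<le> inverse (u ^ Suc n)"
        using u unfolding pole_term_def norm_inverse norm_power by (intro le_imp_inverse_le) auto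
      then have "norm (?F u) \<le> u powr p * inverse (u ^ Suc n)"
        by (simp only: norm_mult norm_of_real) (auto intro!: mult_left_mono)
      also have "\<dots> = u powr (p - of_nat (Suc n))"
        using u by (simp only: powr_diff powr_realpow divide_inverse)
      finally show ?thesis .
    qed
    have "p - of_nat (Suc n) < 0" using assms by simp
    then have "((\<lambda>u. u powr (p - of_nat (Suc n))) \<longlongrightarrow> 0) at_top"
      by (intro tendsto_neg_powr filterlim_ident)
    then have "(?F \<longlongrightarrow> 0) at_top"
      by (rule Lim_null_comparison[rotated]) (use bound' in \<open>auto intro: eventually_mono[OF eventually_gt_at_top[of 0]]\<close>)
    then show "((?F \<circ> real_of_ereal) \<longlongrightarrow> 0) (at_left \<infinity>)"
      by (simp add: ereal_tendsto_simps)
  qed auto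
  then have "(\<integral>u. f u \<partial>halfline) = 0"
    by (simp add: interval_lebesgue_integral_def set_lebesgue_integral_def integral_restrict_space)
  also have "(\<integral>u. f u \<partial>halfline) =
      of_real (p - of_nat (Suc n)) * beta_integral n p - of_nat (Suc n) * \<i> * beta_integral (Suc n) p"
    unfolding f_def beta_integral_def using int
    by (subst Bochner_Integration.integral_diff) auto
  finally show ?thesis by simp
qed

text \<open>Induction by the recurrence, whose factor \<open>p - of_nat (Suc n)\<close> is nonzero
  because \<open>p \<le> 1\<close>. For \<open>n = 1\<close> the integrand has positive imaginary
  part.\<close>

lemma beta_integral_nonzero:
  assumes "0 < p" "p \<le> 1" "n > 0"
  shows "beta_integral n p \<noteq> 0"
proof -
  have "beta_integral (Suc m) p \<noteq> 0" for m
  proof (induction m)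
    case 0
    let ?h = "\<lambda>u. of_real (u powr (p - 1)) * pole_term 1 1 u"
    have int: "integrable halfline ?h" using assms by (intro integrable_beta_integral) auto
    have "Im (?h u) > 0" if u: "u > 0" for u
    proof -
      \<comment> \<open>The denominator is the squared modulus of (u-i)^2 = u^2 - 1 - 2iu.\<close>
      have "Im (pole_term 1 1 u) = 2 * u / ((u\<^sup>2 - 1)\<^sup>2 + (2 * u)\<^sup>2)"
        by (simp add: pole_term_def power2_eq_square) (simp add: algebra_simps)
      also have "\<dots> > 0" using u by (intro divide_pos_pos add_nonneg_pos) auto
      finally show ?thesis using u by simp
    qed
    then have "(\<integral>u. Im (?h u) \<partial>halfline) > 0"
      by (intro integral_halfline_pos integrable_Im int)
    then have "Im (beta_integral 1 p) > 0"
      unfolding beta_integral_def using integral_Im[OF int] by simp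
    then show ?case by auto
  next
    case (Suc m)
    have "of_real (p - of_nat (Suc (Suc m))) * beta_integral (Suc m) p \<noteq> 0"
      using Suc assms by (auto simp del: of_real_diff)
    then show ?case
      using beta_integral_Suc[of p "Suc m"] assms by auto
  qed
  then show ?thesis using assms(3) by (cases n) auto
qed

text \<open>Under x = y u the power gives y^(p-1), the pole y^(-n-1) and the differential y. The
  same scaling of the norms serves to exchange sum and integral.\<close>

lemma has_bochner_integral_powr_pole_term:
  assumes "0 < p" "p \<le> of_nat n" "y > 0"
  shows "has_bochner_integral halfline (\<lambda>x. of_real (x powr (p - 1)) * pole_term n y x)
           (of_real (y powr (p - of_nat n - 1)) * beta_integral n p)"
    and "(\<integral>x. norm (of_real (x powr (p - 1)) * pole_term n y x) \<partial>halfline) =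
          y powr (p - of_nat n - 1) * (\<integral>x. norm (of_real (x powr (p - 1)) * pole_term n 1 x) \<partial>halfline)"
proof -
  let ?h = "\<lambda>y x. of_real (x powr (p - 1)) * pole_term n y x"
  let ?Y = "y powr (p - of_nat n - 1)"
  \<comment> \<open>The division by \<open>y\<close> is undone by the Jacobian of the
    dilation.\<close>
  have scaled: "?h y x = of_real (?Y / y) * ?h 1 (inverse y * x)" if x: "x > 0" for x
  proof -
    have "x powr (p - 1) = y powr (p - 1) * (inverse y * x) powr (p - 1)"
      using x assms(3) by (simp add: mult.assoc[symmetric] flip: powr_mult)
    moreover have "pole_term n y x = of_real (inverse (y ^ Suc n)) * pole_term n 1 (inverse y * x)"
    proof -
      have "of_real x - \<i> * of_real y = of_real y * (of_real (inverse y * x) - \<i> * of_real 1)"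
        using assms(3) by (simp add: field_simps)
      then show ?thesis
        unfolding pole_term_def by (simp only: power_mult_distrib inverse_mult_distrib of_real_inverse of_real_power)
    qed
    moreover have "?Y / y = y powr (p - 1) * inverse (y ^ Suc n)"
    proof -
      have "?Y / y = y powr ((p - of_nat n - 1) - 1)" using assms(3) by (simp add: powr_diff power2_eq_square)
      also have "(p - of_nat n - 1) - 1 = (p - 1) - of_nat (Suc n)" by simp
      finally show ?thesis
        using assms(3) by (simp only: powr_diff powr_realpow divide_inverse)
    qed
    ultimately show ?thesis by (simp only: of_real_mult mult_ac)
  qed
  have 1: "has_bochner_integral halfline (?h 1) (beta_integral n p)"
    unfolding has_bochner_integral_iff beta_integral_def using integrable_beta_integral[OF assms(1,2)] by simp
  have iy: "inverse y > 0" using assms(3) by simp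
  from has_bochner_integral_mult_right[OF has_bochner_integral_halfline_scale[OF 1 iy], of "of_real (?Y / y)"]
  have "has_bochner_integral halfline (\<lambda>x. of_real (?Y / y) * ?h 1 (inverse y * x))
           (of_real (?Y / y) * (beta_integral n p /\<^sub>R inverse y))" by blast
  also have "of_real (?Y / y) * (beta_integral n p /\<^sub>R inverse y) = of_real ?Y * beta_integral n p"
    using assms(3) by (simp add: scaleR_conv_of_real)
  finally show "has_bochner_integral halfline (?h y) (of_real ?Y * beta_integral n p)"
    by (rule has_bochner_integral_cong[THEN iffD1, rotated -1]) (auto simp: scaled space_restrict_space)
  show "(\<integral>x. norm (?h y x) \<partial>halfline) = ?Y * (\<integral>x. norm (?h 1 x) \<partial>halfline)"
  proof -
    have "has_bochner_integral halfline (\<lambda>x. norm (?h 1 x)) (\<integral>x. norm (?h 1 x) \<partial>halfline)"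
      using integrable_norm[OF integrable_beta_integral[OF assms(1,2)]] by (simp add: has_bochner_integral_iff)
    from has_bochner_integral_mult_right[OF has_bochner_integral_halfline_scale[OF this iy], of "?Y / y"]
    have "(\<integral>x. ?Y / y * norm (?h 1 (inverse y * x)) \<partial>halfline) =
        ?Y / y * ((\<integral>x. norm (?h 1 x) \<partial>halfline) /\<^sub>R inverse y)"
      by (intro has_bochner_integral_integral_eq) blast
    also have "(\<integral>x. ?Y / y * norm (?h 1 (inverse y * x)) \<partial>halfline) = (\<integral>x. norm (?h y x) \<partial>halfline)"
      using assms(3)
      by (intro Bochner_Integration.integral_cong refl) (simp add: scaled norm_mult space_restrict_space del: of_real_divide)
    finally show ?thesis using assms(3) by simp
  qed
qed

section \<open>Summation over the poles\<close>

lemma summable_shift_powr: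
  fixes b \<sigma> :: real
  assumes "b > 0" "\<sigma> < 0"
  shows "summable (\<lambda>k. (2 * pi * (b + of_nat k)) powr (\<sigma> - 1))"
proof (rule summable_comparison_test'[where N = 1])
  show "summable (\<lambda>k. of_nat k powr (\<sigma> - 1) :: real)"
    using assms by (simp add: summable_real_powr_iff)
  show "norm ((2 * pi * (b + of_nat k)) powr (\<sigma> - 1)) \<le> of_nat k powr (\<sigma> - 1)" if "k \<ge> 1" for k
  proof -
    have "1 * of_nat k \<le> 2 * pi * (b + of_nat k)"
      using assms pi_ge_two by (intro mult_mono) auto
    then show ?thesis using that assms by (auto intro!: powr_mono2')
  qed
qed

text \<open>The integrals of the norms are a fixed constant times y_k^(p-n-1), where y_k = 2 pi
  (b+k). They are summable because \<open>p < n\<close> makes the exponent less than -1, so termwise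
  integration is allowed.\<close>

lemma integral_pole_sum:
  assumes "0 < p" "p < of_nat n" "b > 0"
  shows "has_bochner_integral halfline
          (\<lambda>x. of_real (x powr (p - 1)) * (\<Sum>k. pole_term n (2 * pi * (b + of_nat k)) x))
          (of_real (\<Sum>k. (2 * pi * (b + of_nat k)) powr (p - of_nat n - 1)) * beta_integral n p)"
proof -
  define y where "y = (\<lambda>k. 2 * pi * (b + of_nat k))"
  have y: "y k > 0" for k using assms by (auto simp: y_def intro!: mult_pos_pos add_pos_nonneg)
  let ?f = "\<lambda>k x. of_real (x powr (p - 1)) * pole_term n (y k) x"
  let ?\<sigma> = "p - of_nat n"
  have n: "n > 0" using assms by (cases n) auto
  have sm: "summable (\<lambda>k. y k powr (?\<sigma> - 1))"
    unfolding y_def using assms by (intro summable_shift_powr) auto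
  have bi: "has_bochner_integral halfline (?f k) (of_real (y k powr (?\<sigma> - 1)) * beta_integral n p)" for k
    using has_bochner_integral_powr_pole_term(1)[OF assms(1) _ y] assms(2) by simp
  have s: "summable (\<lambda>k. norm (?f k x))" for x
    unfolding norm_mult y_def using assms(3) n by (intro summable_mult summable_norm_pole_term)
  have s': "summable (\<lambda>k. \<integral>x. norm (?f k x) \<partial>halfline)"
    using has_bochner_integral_powr_pole_term(2)[OF assms(1) _ y] assms(2) summable_mult2[OF sm] by simp
  have i: "integrable halfline (?f k)" for k using bi by (simp add: has_bochner_integral_iff)
  have eq: "(\<Sum>k. ?f k x) = of_real (x powr (p - 1)) * (\<Sum>k. pole_term n (y k) x)" for x
    unfolding y_def using assms(3) n
    by (intro suminf_mult summable_norm_cancel[OF summable_norm_pole_term])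
  have "integrable halfline (\<lambda>x. \<Sum>k. ?f k x)"
    by (rule integrable_suminf[OF i AE_I2[OF s] s'])
  moreover have "(\<lambda>k. of_real (y k powr (?\<sigma> - 1)) * beta_integral n p) sums (\<integral>x. (\<Sum>k. ?f k x) \<partial>halfline)"
    using sums_integral[OF i AE_I2[OF s] s'] bi by (simp add: has_bochner_integral_iff)
  moreover have "(\<lambda>k. of_real (y k powr (?\<sigma> - 1)) * beta_integral n p) sums
      (of_real (\<Sum>k. y k powr (?\<sigma> - 1)) * beta_integral n p)"
    by (intro sums_mult2 sums_of_real summable_sums sm)
  ultimately have "has_bochner_integral halfline
      (\<lambda>x. of_real (x powr (p - 1)) * (\<Sum>k. pole_term n (y k) x))
      (of_real (\<Sum>k. y k powr (?\<sigma> - 1)) * beta_integral n p)"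
    unfolding eq has_bochner_integral_iff by (auto intro: sums_unique2)
  then show ?thesis by (simp only: y_def)
qed

text \<open>A power with negative exponent is strictly decreasing, so the termwise differences form
  a convergent series of positive terms.\<close>

lemma suminf_shift_powr_strict_antimono:
  assumes "0 < b" "b < c" "\<sigma> < 0"
  shows "(\<Sum>k. (2 * pi * (c + of_nat k)) powr (\<sigma> - 1)) < (\<Sum>k. (2 * pi * (b + of_nat k)) powr (\<sigma> - 1))"
proof -
  let ?f = "\<lambda>b k. (2 * pi * (b + of_nat k)) powr (\<sigma> - 1)"
  have sb: "summable (?f b)" "summable (?f c)" using assms by (auto intro!: summable_shift_powr)
  have "0 < (\<Sum>k. ?f b k - ?f c k)"
  proof (rule suminf_pos)
    show "summable (\<lambda>k. ?f b k - ?f c k)" by (intro summable_diff sb)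
    have "2 * pi * (b + of_nat k) > 0" for k using assms by (auto intro!: mult_pos_pos add_pos_nonneg)
    then show "0 < ?f b k - ?f c k" for k
      using assms by (auto intro!: powr_less_mono2_neg)
  qed
  then show ?thesis using suminf_diff[OF sb] by simp
qed

lemma periodic_zeta_nonzero_neg:
  assumes "0 < a" "a < 1" "a \<noteq> 1 / 2" "\<sigma> < 0"
  shows "periodic_zeta a (of_real \<sigma>) \<noteq> 0"
proof -
  \<comment> \<open>This choice puts p = \<sigma> + n into (0,1], where the Beta integral is known
    not to vanish; p < n because \<open>\<sigma> < 0\<close>.\<close>
  define n where "n = nat (\<lfloor>- \<sigma>\<rfloor> + 1)"
  define p where "p = \<sigma> + of_nat n"
  have n: "real n = of_int \<lfloor>- \<sigma>\<rfloor> + 1" using assms(4) by (simp add: n_def)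
  have p: "0 < p" "p \<le> 1" "p < of_nat n" "n > 0"
  proof -
    show "0 < p" unfolding p_def n by linarith
    show "p \<le> 1" unfolding p_def n by linarith
    show "p < of_nat n" using assms(4) by (simp add: p_def)
    then show "n > 0" using \<open>0 < p\<close> by (cases n) auto
  qed
  define A where "A = (\<lambda>b. \<Sum>k. (2 * pi * (b + of_nat k)) powr (\<sigma> - 1))"
  define J where "J = beta_integral n p"
  let ?S = "\<lambda>b x. \<Sum>k. pole_term n (2 * pi * (b + of_nat k)) x"
  have S: "has_bochner_integral halfline (\<lambda>x. of_real (x powr (p - 1)) * ?S b x) (of_real (A b) * J)"
    if "b > 0" for b
    using integral_pole_sum[OF p(1,3) that] by (simp add: A_def J_def p_def)
  \<comment> \<open>As x^(p-1) is real, conjugation passes through the integral, and the poles of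
    the lower half-plane contribute the conjugate of J.\<close>
  have "has_bochner_integral halfline
      (\<lambda>x. fact n * (of_real (x powr (p - 1)) * ?S a x + cnj (of_real (x powr (p - 1)) * ?S (1 - a) x)))
      (fact n * (of_real (A a) * J + cnj (of_real (A (1 - a)) * J)))"
    using assms by (intro has_bochner_integral_mult_right has_bochner_integral_add has_bochner_integral_cnj S) auto
  then have "has_bochner_integral halfline
      (\<lambda>x. of_real x powr (of_real \<sigma> + of_nat n - 1) * mellin_kernel n a x)
      (fact n * (of_real (A a) * J + cnj (of_real (A (1 - a)) * J)))"
  proof (rule has_bochner_integral_cong[THEN iffD1, rotated -1])
    fix x assume "x \<in> space halfline"
    then have x: "x > 0" by (simp add: space_restrict_space)
    have "of_real x powr (of_real \<sigma> + of_nat n - 1) = complex_of_real (x powr (p - 1))"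
      using powr_of_real[of x "p - 1"] x by (simp add: p_def)
    then show "fact n * (of_real (x powr (p - 1)) * ?S a x + cnj (of_real (x powr (p - 1)) * ?S (1 - a) x)) =
        of_real x powr (of_real \<sigma> + of_nat n - 1) * mellin_kernel n a x"
      using mellin_kernel_eq_pole_sum[OF assms(1,2) x p(4)] by (simp add: algebra_simps)
  qed auto
  then have int: "(\<integral>x. of_real x powr (of_real \<sigma> + of_nat n - 1) * mellin_kernel n a x \<partial>halfline) =
      fact n * (of_real (A a) * J + cnj (of_real (A (1 - a)) * J))"
    by (rule has_bochner_integral_integral_eq)
  have "of_real (A a) * J + cnj (of_real (A (1 - a)) * J) \<noteq> 0"
  proof
    assume "of_real (A a) * J + cnj (of_real (A (1 - a)) * J) = 0"
    \<comment> \<open>Cancelling |J| gives A(a) = A(1-a), against strict monotonicity, since a and 1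
      - a differ.\<close>
    then have "norm (of_real (A a) * J) = norm (cnj (of_real (A (1 - a)) * J))"
      by (metis add_eq_0_iff2 norm_minus_cancel)
    then have "\<bar>A a\<bar> = \<bar>A (1 - a)\<bar>"
      using beta_integral_nonzero[OF p(1,2,4)] by (simp add: norm_mult J_def)
    moreover have "A b \<ge> 0" if "b > 0" for b
      unfolding A_def using that assms(4) by (intro suminf_nonneg summable_shift_powr) auto
    ultimately have "A a = A (1 - a)" using assms by simp
    moreover have "a < 1 - a \<or> 1 - a < a" using assms(3) by auto
    ultimately show False
      using suminf_shift_powr_strict_antimono[of a "1 - a" \<sigma>] suminf_shift_powr_strict_antimono[of "1 - a" a \<sigma>] assms
      unfolding A_def by auto
  qed
  moreover have "rGamma (of_real \<sigma> + of_nat n :: complex) \<noteq> 0"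
    using rGamma_pos_real_nonzero[OF p(1)] by (simp add: p_def)
  moreover have "periodic_zeta a (of_real \<sigma>) = periodic_zeta_rep n a (of_real \<sigma>)"
    using assms p by (intro periodic_zeta_eq_rep) (auto simp: p_def)
  ultimately show ?thesis by (simp add: periodic_zeta_rep_def int)
qed

theorem theorem1p1:
  fixes a :: real
  assumes "0 < a" and "a < 1" and "a \<noteq> 1 / 2"
  shows "\<forall>\<sigma>::real. periodic_zeta a (of_real \<sigma>) \<noteq> 0"
proof
  fix \<sigma> :: real
  show "periodic_zeta a (of_real \<sigma>) \<noteq> 0"
    \<comment> \<open>The ranges \<open>\<sigma> < 0\<close> and \<open>\<sigma> > -1\<close>
      together cover the real line.\<close>
    using periodic_zeta_nonzero_neg[OF assms] periodic_zeta_nonzero_gt_minus1[OF assms]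
    by (cases "\<sigma> < 0") auto
qed

end
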